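(* Let $\kappa\in(0,+\infty)$ and let $W$ be a multigraphon with $\rho:=\rho(W)>0$ such that there are adjacency matrices $B_n\in\mathcal A_n$ ($n\in\mathbb N$) with $B_n\to W$ and constants $\lambda>0$, $C<+\infty$ with $$\frac{1}{\binom n2}\sum_{1\le i<j\le n}e^{\lambda B_n(i,j)}\le C,\qquad \frac1n\sum_{i=1}^n e^{\lambda B_n(i,i)}\le C\qquad\text{for all } n.$$ Let $W_t$, $\hat W_t$ ($t>0$) and $\hat W_\infty$ be the multigraphons defined in the context. Then $$\lim_{t\to0_+}W_t\cong W,\qquad \lim_{t\to\infty}W_t\cong\lim_{t\to0_+}\hat W_t,\qquad \lim_{t\to\infty}\hat W_t\cong\hat W_\infty .$$ That is, for every $k\in\mathbb N$ and $A\in\mathcal A_k$: $\lim_{t\to0_+}t_=(A,W_t)=t_=(A,W)$; there is a multigraphon $V$ (not depending on $A$) such that $\lim_{t\to\infty}t_=(A,W_t)=t_=(A,V)=\lim_{t\to0_+}t_=(A,\hat W_t)$; and $\lim_{t\to\infty}t_=(A,\hat W_t)=t_=(A,\hat W_\infty)$.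
   Context: **Adjacency matrices.** $\mathbb N_0=\{0,1,2,\dots\}$, $[n]=\{1,\dots,n\}$. $\mathcal A_n$ is the set of symmetric matrices $B\in\mathbb N_0^{n\times n}$ with all diagonal entries even. **Multigraphons.** A multigraphon is a measurable function $W:[0,1]\times[0,1]\times\mathbb N_0\to[0,1]$ with $W(x,y,l)=W(y,x,l)$, $\sum_{l=0}^\infty W(x,y,l)=1$, and $W(x,x,2l+1)=0$ for all $x,y\in[0,1]$, $l\in\mathbb N_0$. Put $$D(W,x)=\int_0^1\sum_{l=0}^\infty l\,W(x,y,l)\,dy,\qquad \rho(W)=\int_0^1 D(W,x)\,dx .$$ (If $\rho(W)<\infty$ then $D(W,x)<\infty$ for almost every $x$; values on null sets of $x$ are immaterial.) **Densities and convergence.** For $A\in\mathcal A_k$, $B\in\mathcal A_n$ and a multigraphon $W$ let $$t_=(A,B)=\frac1{n^k}\sum_{\varphi:[k]\to[n]}\mathbf 1\big[\forall i,j\in[k]:A(i,j)=B(\varphi(i),\varphi(j))\big],$$ $$t_=(A,W)=\int_{[0,1]^k}\prod_{1\le i\le j\le k}W(x_i,x_j,A(i,j))\,dx_1\cdots dx_k .$$ $B_n\to W$ means $t_=(A,B_n)\to t_=(A,W)$ for all $k$ and all $A\in\mathcal A_k$. $W_1\cong W_2$ means $t_=(A,W_1)=t_=(A,W_2)$ for all $k$ and all $A\in\mathcal A_k$. Convergence of multigraphons means convergence of $t_=(A,\cdot)$ for all $k$ and all $A\in\mathcal A_k$ to the value at the limiting multigraphon; limits are determined up to $\cong$. **Auxiliary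 functions.** $\mathbf p(k,\lambda)=e^{-\lambda}\lambda^k/k!$ (with $\mathbf p(0,0)=1$), $\mathbf b(l,h,p)=\binom hl p^l(1-p)^{h-l}$ (equal to $0$ for $l>h$), $\mathbf g(x,\alpha,\beta)=x^{\alpha-1}\frac{\beta^\alpha e^{-\beta x}}{\Gamma(\alpha)}\mathbf 1[x>0]$, and $$\mathbf q(t,h,k,\mu)=\sum_{l=0}^k\mathbf b(l,h,e^{-t})\,\mathbf p\big(k-l,(1-e^{-t})\mu\big).$$ With $\alpha=\kappa/\rho$ and $\tau(\alpha,t)=\frac{\alpha}{\exp(\alpha t)-1}$, put for $t>0$ $$f(t,z,y)=\sum_{i=0}^\infty\mathbf p\big(i,z\,\tau(\alpha,t)\big)\,\mathbf g\big(y,\kappa+i,\tau(\alpha,t)+\alpha\big).$$ **The multigraphons.** For $t>0$, $$W_t(x,y,k)=\begin{cases}\sum_{h=0}^\infty W(x,y,h)\,\mathbf q\big(t,h,k,\frac{D(W,x)D(W,y)}{\rho}\big)& x\ne y,\\ \mathbf 1[2\mid k]\sum_{h=0}^\infty W(x,y,h)\,\mathbf q\big(t,\frac h2,\frac k2,\frac{D(W,x)D(W,y)}{2\rho}\big)& x=y\end{cases}$$ (for $x=y$ the terms with odd $h$ vanish). For a distribution function $F$ on $[0,\infty)$ with inverse $F^{-1}(x)=\min\{z:F(z)\ge x\}$, let $$W^F(x,y,k)=\begin{cases}\mathbf p\big(k,\frac{F^{-1}(x)F^{-1}(y)}{\rho}\big)& x\ne y,\\ \mathbf 1[2\mid k]\,\mathbf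 p\big(\frac k2,\frac{F^{-1}(x)F^{-1}(y)}{2\rho}\big)& x=y.\end{cases}$$ Then $\hat W_t=W^{F_t}$ for $t>0$, where $F_t(x)=\int_0^x f(t,y)\,dy$, $f(t,y)=\int_0^\infty f(t,z,y)\,dF_0(z)$, $F_0(x)=\int_0^1\mathbf 1[D(W,y)\le x]\,dy$; and $\hat W_\infty=W^{F}$ with $F(x)=\int_0^x\mathbf g(y,\kappa,\frac\kappa\rho)\,dy$. (Values at $x\in\{0,1\}$ or $y\in\{0,1\}$ are immaterial.) For $n=1$ the condition involving $\binom n2$ is regarded as vacuous. *)

theory Defs
  imports "HOL-Analysis.Analysis"
begin

text \<open>
  An \<open>n \<times> n\<close> matrix is a function of two indices in \<open>{1..n}\<close>; its values at other indices
  are irrelevant to every definition below.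
\<close>

definition adj_mats :: "nat \<Rightarrow> (nat \<Rightarrow> nat \<Rightarrow> nat) set" where
  "adj_mats n = {B. (\<forall>i\<in>{1..n}. \<forall>j\<in>{1..n}. B i j = B j i) \<and> (\<forall>i\<in>{1..n}. even (B i i))}"

text \<open>
  Measurability is Borel measurability. Lebesgue measurability would not control the restriction
  of \<open>W\<close> to the diagonal, which enters the densities below.
\<close>

definition multigraphon :: "(real \<Rightarrow> real \<Rightarrow> nat \<Rightarrow> real) \<Rightarrow> bool" where
  "multigraphon W \<longleftrightarrow>
     (\<lambda>(x, y, l). W x y l) \<in> borel_measurable
        (restrict_space borel {0..1} \<Otimes>\<^sub>M restrict_space borel {0..1} \<Otimes>\<^sub>M count_space UNIV) \<and>
     (\<forall>x\<in>{0..1}. \<forall>y\<in>{0..1}. \<forall>l. 0 \<le> W x y l \<and> W x y l \<le> 1) \<and>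
     (\<forall>x\<in>{0..1}. \<forall>y\<in>{0..1}. \<forall>l. W x y l = W y x l) \<and>
     (\<forall>x\<in>{0..1}. \<forall>y\<in>{0..1}. (\<lambda>l. W x y l) sums 1) \<and>
     (\<forall>x\<in>{0..1}. \<forall>l. W x x (2 * l + 1) = 0)"

definition mg_degree :: "(real \<Rightarrow> real \<Rightarrow> nat \<Rightarrow> real) \<Rightarrow> real \<Rightarrow> ennreal" where
  "mg_degree W x = (\<integral>\<^sup>+ y \<in> {0..1}. (\<Sum>l. ennreal (real l * W x y l)) \<partial>lborel)"

definition mg_rho :: "(real \<Rightarrow> real \<Rightarrow> nat \<Rightarrow> real) \<Rightarrow> ennreal" where
  "mg_rho W = (\<integral>\<^sup>+ x \<in> {0..1}. mg_degree W x \<partial>lborel)"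

text \<open>
  Real-valued versions, with \<open>\<infinity>\<close> replaced by \<open>0\<close>. If \<open>mg_rho W < \<infinity>\<close>, this changes the degree
  only on a null set.
\<close>

definition mg_deg :: "(real \<Rightarrow> real \<Rightarrow> nat \<Rightarrow> real) \<Rightarrow> real \<Rightarrow> real" where
  "mg_deg W x = enn2real (mg_degree W x)"

definition mg_dens :: "(real \<Rightarrow> real \<Rightarrow> nat \<Rightarrow> real) \<Rightarrow> real" where
  "mg_dens W = enn2real (mg_rho W)"

definition t_eq_mat :: "nat \<Rightarrow> (nat \<Rightarrow> nat \<Rightarrow> nat) \<Rightarrow> nat \<Rightarrow> (nat \<Rightarrow> nat \<Rightarrow> nat) \<Rightarrow> real" where
  "t_eq_mat k A n B =
     1 / real n ^ k *
     (\<Sum>\<phi>\<in>{1..k} \<rightarrow>\<^sub>E {1..n}. of_bool (\<forall>i\<in>{1..k}. \<forall>j\<in>{1..k}. A i j = B (\<phi> i) (\<phi> j)))"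

definition t_eq :: "nat \<Rightarrow> (nat \<Rightarrow> nat \<Rightarrow> nat) \<Rightarrow> (real \<Rightarrow> real \<Rightarrow> nat \<Rightarrow> real) \<Rightarrow> real" where
  "t_eq k A W =
     (\<integral>x. (\<Prod>i\<in>{1..k}. \<Prod>j\<in>{i..k}. W (x i) (x j) (A i j))
        \<partial>(\<Pi>\<^sub>M i\<in>{1..k}. restrict_space lborel {0..1}))"

definition mats_tendsto ::
  "(nat \<Rightarrow> nat \<Rightarrow> nat \<Rightarrow> nat) \<Rightarrow> (real \<Rightarrow> real \<Rightarrow> nat \<Rightarrow> real) \<Rightarrow> bool" where
  "mats_tendsto B W \<longleftrightarrow>
     (\<forall>k\<ge>1. \<forall>A\<in>adj_mats k. (\<lambda>n. t_eq_mat k A n (B n)) \<longlonglongrightarrow> t_eq k A W)"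

definition mg_tendsto ::
  "('t \<Rightarrow> real \<Rightarrow> real \<Rightarrow> nat \<Rightarrow> real) \<Rightarrow> (real \<Rightarrow> real \<Rightarrow> nat \<Rightarrow> real) \<Rightarrow> 't filter \<Rightarrow> bool" where
  "mg_tendsto U V F \<longleftrightarrow>
     (\<forall>k\<ge>1. \<forall>A\<in>adj_mats k. ((\<lambda>t. t_eq k A (U t)) \<longlongrightarrow> t_eq k A V) F)"

definition poi :: "nat \<Rightarrow> real \<Rightarrow> real" where
  "poi k l = exp (- l) * l ^ k / fact k"

definition bino :: "nat \<Rightarrow> nat \<Rightarrow> real \<Rightarrow> real" where
  "bino l h p = real (h choose l) * p ^ l * (1 - p) ^ (h - l)"

definition gamma_dens :: "real \<Rightarrow> real \<Rightarrow> real \<Rightarrow> real" where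
  "gamma_dens x a b =
     (if x > 0 then x powr (a - 1) * (b powr a * exp (- b * x) / Gamma a) else 0)"

definition qker :: "real \<Rightarrow> nat \<Rightarrow> nat \<Rightarrow> real \<Rightarrow> real" where
  "qker t h k \<mu> = (\<Sum>l=0..k. bino l h (exp (- t)) * poi (k - l) ((1 - exp (- t)) * \<mu>))"

definition tau :: "real \<Rightarrow> real \<Rightarrow> real" where
  "tau \<alpha> t = \<alpha> / (exp (\<alpha> * t) - 1)"

definition fker :: "real \<Rightarrow> real \<Rightarrow> real \<Rightarrow> real \<Rightarrow> real \<Rightarrow> real" where
  "fker \<kappa> \<rho> t z y =
     (let \<alpha> = \<kappa> / \<rho> in
      \<Sum>i. poi i (z * tau \<alpha> t) * gamma_dens y (\<kappa> + real i) (tau \<alpha> t + \<alpha>))"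

text \<open>
  In the diagonal case \<open>h div 2\<close> is exact on all nonzero terms, as \<open>W x x h = 0\<close> for odd \<open>h\<close>.
\<close>

definition mg_evol ::
  "(real \<Rightarrow> real \<Rightarrow> nat \<Rightarrow> real) \<Rightarrow> real \<Rightarrow> real \<Rightarrow> real \<Rightarrow> nat \<Rightarrow> real" where
  "mg_evol W t x y k =
     (if x \<noteq> y
      then (\<Sum>h. W x y h * qker t h k (mg_deg W x * mg_deg W y / mg_dens W))
      else of_bool (even k) *
           (\<Sum>h. W x y h *
              qker t (h div 2) (k div 2) (mg_deg W x * mg_deg W y / (2 * mg_dens W))))"

text \<open>
  The least element exists for \<open>x\<close> in \<open>{0..<1}\<close> when \<open>F\<close> is a distribution function on the closed
  half-line; the value at the single point \<open>x = 1\<close> may be unspecified.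
\<close>

definition quantile :: "(real \<Rightarrow> real) \<Rightarrow> real \<Rightarrow> real" where
  "quantile F x = (LEAST z. 0 \<le> z \<and> x \<le> F z)"

definition mg_of_distr :: "real \<Rightarrow> (real \<Rightarrow> real) \<Rightarrow> real \<Rightarrow> real \<Rightarrow> nat \<Rightarrow> real" where
  "mg_of_distr \<rho> F x y k =
     (if x \<noteq> y
      then poi k (quantile F x * quantile F y / \<rho>)
      else of_bool (even k) * poi (k div 2) (quantile F x * quantile F y / (2 * \<rho>)))"

definition deg_distr0 :: "(real \<Rightarrow> real \<Rightarrow> nat \<Rightarrow> real) \<Rightarrow> real \<Rightarrow> real" where
  "deg_distr0 W x = (LINT y:{0..1}|lborel. of_bool (mg_deg W y \<le> x))"

text \<open>
  The integral against \<open>dF\<^sub>0\<close> is over the closed half-line: it includes a possible atom at \<open>0\<close>.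
\<close>

definition deg_dens :: "real \<Rightarrow> (real \<Rightarrow> real \<Rightarrow> nat \<Rightarrow> real) \<Rightarrow> real \<Rightarrow> real \<Rightarrow> real" where
  "deg_dens \<kappa> W t y =
     (LINT z:{0..}|interval_measure (deg_distr0 W). fker \<kappa> (mg_dens W) t z y)"

definition deg_distr :: "real \<Rightarrow> (real \<Rightarrow> real \<Rightarrow> nat \<Rightarrow> real) \<Rightarrow> real \<Rightarrow> real \<Rightarrow> real" where
  "deg_distr \<kappa> W t x = (LINT y:{0..x}|lborel. deg_dens \<kappa> W t y)"

definition mg_hat ::
  "real \<Rightarrow> (real \<Rightarrow> real \<Rightarrow> nat \<Rightarrow> real) \<Rightarrow> real \<Rightarrow> real \<Rightarrow> real \<Rightarrow> nat \<Rightarrow> real" where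
  "mg_hat \<kappa> W t = mg_of_distr (mg_dens W) (deg_distr \<kappa> W t)"

definition mg_hat_inf ::
  "real \<Rightarrow> (real \<Rightarrow> real \<Rightarrow> nat \<Rightarrow> real) \<Rightarrow> real \<Rightarrow> real \<Rightarrow> nat \<Rightarrow> real" where
  "mg_hat_inf \<kappa> W =
     mg_of_distr (mg_dens W)
       (\<lambda>x. LINT y:{0..x}|lborel. gamma_dens y \<kappa> (\<kappa> / mg_dens W))"

end

theory Submission
  imports Defs "HOL-Probability.Probability"
begin

text \<open>
  As \<open>t \<rightarrow> 0\<close> and \<open>t \<rightarrow> \<infinity>\<close> the kernel \<open>q(t, h, k, \<mu>)\<close> tends to the point mass at \<open>h\<close> and to the
  Poisson distribution with mean \<open>\<mu>\<close>, so dominated convergence yields the limits of \<open>W\<^sub>t\<close>; the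
  second one is the Poisson multigraphon \<open>V\<close> built from the degree function \<open>D(W, \<cdot>)\<close>. The
  exponential moments of \<open>B\<^sub>n\<close> enter only through \<open>\<rho>(W) < \<infinity>\<close>, which follows from the densities with
  \<open>k = 2\<close> and Fatou's lemma.

  The density of a Poisson multigraphon depends only on the law of its weight function: it is the
  expectation of a bounded continuous function of independent samples, hence weakly continuous in
  that law. For \<open>V\<close> the law is \<open>F\<^sub>0\<close>, for the multigraphon with hat at time \<open>t\<close> it is \<open>F\<^sub>t\<close>, a mixture of
  gamma distributions with a Poisson number of extra shape units. Its mean square distance from the
  starting point \<open>z\<close> vanishes as \<open>t \<rightarrow> 0\<close>, so \<open>F\<^sub>t \<rightarrow> F\<^sub>0\<close> by Chebyshev's inequality, and the Poisson number
  vanishes as \<open>t \<rightarrow> \<infinity>\<close>, which leaves the gamma distribution with parameters \<open>\<kappa>\<close> and \<open>\<kappa> / \<rho>\<close>.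
\<close>

section \<open>Limits of densities\<close>

definition unit_lebesgue :: "real measure" where
  "unit_lebesgue = restrict_space lborel {0..1}"

lemma space_unit_lebesgue [simp]: "space unit_lebesgue = {0..1}"
  by (simp add: unit_lebesgue_def space_restrict_space)

lemma sets_unit_lebesgue [measurable_cong]:
  "sets unit_lebesgue = sets (restrict_space borel {0..1})"
  unfolding unit_lebesgue_def by (rule sets_restrict_space_cong) simp

lemma prob_space_unit_lebesgue: "prob_space unit_lebesgue"
  by (rule prob_spaceI)
     (simp add: unit_lebesgue_def emeasure_restrict_space space_restrict_space)

interpretation unit: prob_space unit_lebesgue
  by (rule prob_space_unit_lebesgue)

interpretation cube: product_prob_space "\<lambda>_. unit_lebesgue" I for I :: "nat set"
  by (rule product_prob_spaceI) (rule prob_space_unit_lebesgue)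

lemma borel_imp_measurable_unit [measurable (raw)]:
  "f \<in> borel_measurable borel \<Longrightarrow> f \<in> borel_measurable unit_lebesgue"
  by (simp add: measurable_restrict_space1 measurable_cong_sets[OF sets_unit_lebesgue refl])

lemma id_measurable_unit [measurable]: "(\<lambda>x. x) \<in> borel_measurable unit_lebesgue"
  by (rule borel_imp_measurable_unit) simp

lemma AE_unit_lebesgue_neq: "AE x in unit_lebesgue. x \<noteq> c"
  unfolding unit_lebesgue_def
  by (subst AE_restrict_space_iff) (use AE_lborel_singleton[of c] in \<open>auto elim: eventually_mono\<close>)

text \<open>A density fixes every multiplicity through \<open>A\<close>, so its integrand calls for
  measurability at each single \<open>l\<close>. Together with \<open>unit_bounded\<close> this is
  the form in which approximating kernels enter the limit arguments.\<close>

definition slicewise_measurable :: "(real \<Rightarrow> real \<Rightarrow> nat \<Rightarrow> real) \<Rightarrow> bool" where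
  "slicewise_measurable W \<longleftrightarrow>
     (\<forall>l. (\<lambda>(x, y). W x y l) \<in> borel_measurable (unit_lebesgue \<Otimes>\<^sub>M unit_lebesgue))"

definition unit_bounded :: "(real \<Rightarrow> real \<Rightarrow> nat \<Rightarrow> real) \<Rightarrow> bool" where
  "unit_bounded W \<longleftrightarrow> (\<forall>x\<in>{0..1}. \<forall>y\<in>{0..1}. \<forall>l. 0 \<le> W x y l \<and> W x y l \<le> 1)"

lemma multigraphon_slicewise_measurable:
  assumes "multigraphon W"
  shows "slicewise_measurable W"
  unfolding slicewise_measurable_def
proof
  fix l :: nat
  have W: "(\<lambda>(x, y, l). W x y l) \<in> borel_measurable
        (unit_lebesgue \<Otimes>\<^sub>M unit_lebesgue \<Otimes>\<^sub>M count_space UNIV)"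
    using assms unfolding multigraphon_def
    by (subst measurable_cong_sets[OF _ refl, where M'="restrict_space borel {0..1}
          \<Otimes>\<^sub>M restrict_space borel {0..1} \<Otimes>\<^sub>M count_space UNIV"])
       (auto intro!: sets_pair_measure_cong sets_unit_lebesgue)
  have "(\<lambda>(x, y). (x, y, l)) \<in> unit_lebesgue \<Otimes>\<^sub>M unit_lebesgue \<rightarrow>\<^sub>M
          unit_lebesgue \<Otimes>\<^sub>M unit_lebesgue \<Otimes>\<^sub>M count_space UNIV"
    by measurable
  from measurable_compose[OF this W]
  show "(\<lambda>(x, y). W x y l) \<in> borel_measurable (unit_lebesgue \<Otimes>\<^sub>M unit_lebesgue)"
    by (simp add: case_prod_unfold)
qed

lemma multigraphon_unit_bounded: "multigraphon W \<Longrightarrow> unit_bounded W"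
  by (simp add: multigraphon_def unit_bounded_def)

lemma slicewise_measurable_comp:
  assumes "slicewise_measurable W"
    and [measurable]: "f \<in> M \<rightarrow>\<^sub>M unit_lebesgue" "g \<in> M \<rightarrow>\<^sub>M unit_lebesgue"
  shows "(\<lambda>x. W (f x) (g x) l) \<in> borel_measurable M"
proof -
  have "(\<lambda>x. (f x, g x)) \<in> M \<rightarrow>\<^sub>M unit_lebesgue \<Otimes>\<^sub>M unit_lebesgue"
    by measurable
  moreover have "(\<lambda>(x, y). W x y l) \<in> borel_measurable (unit_lebesgue \<Otimes>\<^sub>M unit_lebesgue)"
    using assms(1) by (simp add: slicewise_measurable_def)
  ultimately show ?thesis
    using measurable_compose by fastforce
qed

abbreviation cube_measure :: "nat \<Rightarrow> (nat \<Rightarrow> real) measure" where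
  "cube_measure k \<equiv> (\<Pi>\<^sub>M i\<in>{1..k}. unit_lebesgue)"

lemma t_eq_unit_lebesgue:
  "t_eq k A W = (\<integral>x. (\<Prod>i\<in>{1..k}. \<Prod>j\<in>{i..k}. W (x i) (x j) (A i j)) \<partial>cube_measure k)"
  by (simp add: t_eq_def unit_lebesgue_def)

lemma integrand_measurable [measurable]:
  assumes "slicewise_measurable W"
  shows "(\<lambda>x. \<Prod>i\<in>{1..k}. \<Prod>j\<in>{i..k}. W (x i) (x j) (A i j)) \<in> borel_measurable (cube_measure k)"
  by (intro borel_measurable_prod slicewise_measurable_comp[OF assms] measurable_component_singleton) auto

lemma cube_coordinate: "x \<in> space (cube_measure k) \<Longrightarrow> i \<in> {1..k} \<Longrightarrow> 0 \<le> x i \<and> x i \<le> 1"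
  by (auto simp: space_PiM PiE_iff)

lemma abs_prod_le_1:
  fixes f :: "'a \<Rightarrow> real"
  assumes "\<And>i. i \<in> I \<Longrightarrow> \<bar>f i\<bar> \<le> 1"
  shows "\<bar>\<Prod>i\<in>I. f i\<bar> \<le> 1"
  unfolding abs_prod by (rule prod_le_1) (use assms in auto)

lemma integrand_bounded:
  assumes "unit_bounded W" "x \<in> space (cube_measure k)"
  shows "\<bar>\<Prod>i\<in>{1..k}. \<Prod>j\<in>{i..k}. W (x i) (x j) (A i j)\<bar> \<le> 1"
proof (intro abs_prod_le_1)
  fix i j assume "i \<in> {1..k}" "j \<in> {i..k}"
  then have "x i \<in> {0..1}" "x j \<in> {0..1}"
    using cube_coordinate[OF assms(2)] by auto
  then show "\<bar>W (x i) (x j) (A i j)\<bar> \<le> 1"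
    using assms(1) unfolding unit_bounded_def by (metis abs_of_nonneg)
qed

text \<open>The integrand of a density is a finite product of values in [0, 1], so the constant 1
  dominates it on the cube. Pointwise convergence is asked on the diagonal too, because the factors
  with \<open>i = j\<close> evaluate the kernel there.\<close>

lemma mg_tendsto_pointwise:
  assumes U: "\<And>n. slicewise_measurable (U n)" "\<And>n. unit_bounded (U n)"
    and V: "slicewise_measurable V"
    and lim: "\<And>x y l. x \<in> {0..1} \<Longrightarrow> y \<in> {0..1} \<Longrightarrow> (\<lambda>n. U n x y l) \<longlonglongrightarrow> V x y l"
  shows "mg_tendsto U V sequentially"
  unfolding mg_tendsto_def t_eq_unit_lebesgue
proof (intro allI impI ballI integral_dominated_convergence[where w="\<lambda>_. 1"])
  fix k :: nat and A :: "nat \<Rightarrow> nat \<Rightarrow> nat"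
  show "(\<lambda>x. \<Prod>i\<in>{1..k}. \<Prod>j\<in>{i..k}. V (x i) (x j) (A i j)) \<in> borel_measurable (cube_measure k)"
    by (rule integrand_measurable[OF V])
  show "(\<lambda>x. \<Prod>i\<in>{1..k}. \<Prod>j\<in>{i..k}. U n (x i) (x j) (A i j)) \<in> borel_measurable (cube_measure k)" for n
    by (rule integrand_measurable[OF U(1)])
  show "AE x in cube_measure k. norm (\<Prod>i\<in>{1..k}. \<Prod>j\<in>{i..k}. U n (x i) (x j) (A i j)) \<le> 1" for n
    by (rule AE_I2) (simp only: real_norm_def integrand_bounded[OF U(2)])
  show "AE x in cube_measure k. (\<lambda>n. \<Prod>i\<in>{1..k}. \<Prod>j\<in>{i..k}. U n (x i) (x j) (A i j))
      \<longlonglongrightarrow> (\<Prod>i\<in>{1..k}. \<Prod>j\<in>{i..k}. V (x i) (x j) (A i j))"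
  proof (intro AE_I2 tendsto_prod lim)
    fix x i j assume *: "x \<in> space (cube_measure k)" "i \<in> {1..k}" "j \<in> {i..k}"
    then show "x i \<in> {0..1}" "x j \<in> {0..1}"
      using cube_coordinate[OF *(1)] by auto
  qed
  show "integrable (cube_measure k) (\<lambda>_. 1 :: real)"
    by simp
qed

text \<open>Limits along positive null sequences determine the right-hand limit at 0; dominated
  convergence is thus applied to sequences only.\<close>

lemma mg_tendsto_at_right_0:
  assumes "\<And>S. (\<And>n. S n > 0) \<Longrightarrow> S \<longlonglongrightarrow> 0 \<Longrightarrow> mg_tendsto (\<lambda>n. U (S n)) V sequentially"
  shows "mg_tendsto U V (at_right (0::real))"
  unfolding mg_tendsto_def
  by (intro allI ballI impI tendsto_at_right_sequentially[of 0 1])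
     (use assms in \<open>auto simp: mg_tendsto_def\<close>)

lemma mg_tendsto_at_top:
  assumes "\<And>S :: nat \<Rightarrow> real. (\<And>n. S n > 0) \<Longrightarrow> filterlim S at_top sequentially \<Longrightarrow>
              mg_tendsto (\<lambda>n. U (S n)) V sequentially"
  shows "mg_tendsto U V at_top"
  unfolding mg_tendsto_def
proof (intro allI ballI impI tendsto_at_topI_sequentially)
  fix k A and X :: "nat \<Rightarrow> real"
  assume kA: "1 \<le> k" "A \<in> adj_mats k" and X: "filterlim X at_top sequentially"
  \<comment> \<open>A sequence tending to infinity is positive only from some index on; passing to
    \<open>max 1 (X n)\<close> makes all terms positive and changes only finitely many.\<close>
  have ev: "\<forall>\<^sub>F n in sequentially. max 1 (X n) = X n"
    using X[unfolded filterlim_at_top, rule_format, of 1] by eventually_elim simp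
  have "filterlim (\<lambda>n. max 1 (X n)) at_top sequentially"
    using X ev by (subst filterlim_cong[OF refl refl ev]) auto
  then have "mg_tendsto (\<lambda>n. U (max 1 (X n))) V sequentially"
    by (intro assms) auto
  then have "(\<lambda>n. t_eq k A (U (max 1 (X n)))) \<longlonglongrightarrow> t_eq k A V"
    using kA by (simp add: mg_tendsto_def)
  then show "(\<lambda>n. t_eq k A (U (X n))) \<longlonglongrightarrow> t_eq k A V"
    by (rule Lim_transform_eventually) (use ev in eventually_elim, simp)
qed

section \<open>The kernels\<close>

lemma poi_nonneg: "0 \<le> l \<Longrightarrow> 0 \<le> poi k l"
  by (simp add: poi_def)

lemma poi_sums: "(\<lambda>k. poi k l) sums 1"
proof -
  have "(\<lambda>k. exp (- l) * (l ^ k /\<^sub>R fact k)) sums (exp (- l) * exp l)"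
    by (intro sums_mult exp_converges)
  then show ?thesis
    by (simp add: poi_def exp_minus_inverse mult.commute[of "exp (-l)"] field_simps
        flip: exp_add)
qed

lemma poi_le_1:
  assumes "0 \<le> l" shows "poi k l \<le> 1"
proof -
  have "(\<Sum>i\<in>{k}. poi i l) \<le> (\<Sum>i. poi i l)"
    using poi_nonneg[OF assms] poi_sums[of l]
    by (intro sum_le_suminf) (auto simp: sums_iff)
  then show ?thesis
    using poi_sums[of l] by (simp add: sums_iff)
qed

lemma poi_tendsto [tendsto_intros]:
  "(f \<longlongrightarrow> l) F \<Longrightarrow> ((\<lambda>x. poi k (f x)) \<longlongrightarrow> poi k l) F"
  unfolding poi_def by (intro tendsto_intros) auto

lemma poi_measurable [measurable]: "poi k \<in> borel_measurable borel"
  unfolding poi_def[abs_def] by measurable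

lemma poi_0: "poi k 0 = of_bool (k = 0)"
  by (simp add: poi_def)

lemma bino_nonneg: "0 \<le> p \<Longrightarrow> p \<le> 1 \<Longrightarrow> 0 \<le> bino l h p"
  by (simp add: bino_def)

lemma sum_bino: "(\<Sum>l\<le>h. bino l h p) = 1"
  unfolding bino_def by (subst binomial_ring[symmetric]) simp

lemma bino_eq_0: "h < l \<Longrightarrow> bino l h p = 0"
  by (simp add: bino_def)

lemma bino_at_1: "bino l h 1 = of_bool (l = h)"
  by (cases "l < h"; cases "l = h") (auto simp: bino_def)

lemma bino_at_0: "bino l h 0 = of_bool (l = 0)"
  by (cases l) (auto simp: bino_def)

text \<open>\<open>qker\<close> is the mass at \<open>k\<close> of a binomial variable (surviving
  edges) plus an independent Poisson variable (new edges). For the upper bound each Poisson factor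
  is at most 1, and the remaining binomial weights, zero beyond \<open>h\<close>, add up to at most
  1.\<close>

lemma qker_bounds:
  assumes "t > 0" "\<mu> \<ge> 0"
  shows "0 \<le> qker t h k \<mu>" "qker t h k \<mu> \<le> 1"
proof -
  define p where "p = exp (- t)"
  have p: "0 \<le> p" "p \<le> 1" "0 \<le> (1 - p) * \<mu>"
    using assms by (auto simp: p_def)
  show "0 \<le> qker t h k \<mu>"
    unfolding qker_def p_def[symmetric]
    by (intro sum_nonneg mult_nonneg_nonneg bino_nonneg poi_nonneg p)
  have "qker t h k \<mu> \<le> (\<Sum>l=0..k. bino l h p)"
    unfolding qker_def p_def[symmetric]
    by (intro sum_mono mult_left_le bino_nonneg poi_le_1 p)
  also have "\<dots> = (\<Sum>l\<in>{0..k} \<inter> {..h}. bino l h p)"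
    by (intro sum.mono_neutral_right) (auto simp: bino_eq_0)
  also have "\<dots> \<le> (\<Sum>l\<le>h. bino l h p)"
    by (intro sum_mono2 bino_nonneg p) auto
  finally show "qker t h k \<mu> \<le> 1"
    by (simp add: sum_bino)
qed

lemma qker_measurable [measurable]: "qker t h k \<in> borel_measurable borel"
  unfolding qker_def[abs_def] by measurable

text \<open>Time enters \<open>qker\<close> only through \<open>exp (- t)\<close>. Its limit is
  \<open>p = 1\<close> at time 0, where all \<open>h\<close> edges survive and the Poisson mean is
  0, and \<open>p = 0\<close> at infinity, where no edge survives and the Poisson mean is
  \<mu>.\<close>

lemma qker_tendsto_aux:
  assumes "(\<lambda>n. exp (- S n)) \<longlonglongrightarrow> p"
  shows "(\<lambda>n. qker (S n) h k \<mu>) \<longlonglongrightarrow> (\<Sum>l=0..k. bino l h p * poi (k - l) ((1 - p) * \<mu>))"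
  unfolding qker_def bino_def by (intro tendsto_intros assms)

lemma qker_tendsto_0:
  assumes "S \<longlonglongrightarrow> 0"
  shows "(\<lambda>n. qker (S n) h k \<mu>) \<longlonglongrightarrow> of_bool (h = k)"
proof -
  have "(\<lambda>n. exp (- S n)) \<longlonglongrightarrow> exp (- 0)"
    by (intro tendsto_intros assms)
  from qker_tendsto_aux[OF this[simplified]]
  have "(\<lambda>n. qker (S n) h k \<mu>) \<longlonglongrightarrow> (\<Sum>l=0..k. of_bool (l = h) * of_bool (k - l = 0))"
    unfolding diff_self mult_zero_left bino_at_1 poi_0 .
  \<comment> \<open>Subtraction is truncated, but \<open>l\<close> runs only up to \<open>k\<close>,
    so \<open>k - l = 0\<close> singles out \<open>l = k\<close>.\<close>
  also have "(\<Sum>l=0..k. of_bool (l = h) * of_bool (k - l = 0) :: real) = (\<Sum>l\<in>{k}. of_bool (l = h))"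
    by (intro sum.mono_neutral_cong_right) auto
  also have "\<dots> = of_bool (h = k)"
    by (simp add: eq_commute)
  finally show ?thesis .
qed

lemma qker_tendsto_infinity:
  assumes "filterlim S at_top sequentially"
  shows "(\<lambda>n. qker (S n) h k \<mu>) \<longlonglongrightarrow> poi k \<mu>"
proof -
  have "(\<lambda>n. exp (- S n)) \<longlonglongrightarrow> 0"
    using assms by (intro filterlim_compose[OF exp_at_bot] filterlim_uminus_at_bot_at_top[THEN filterlim_compose])
  from qker_tendsto_aux[OF this]
  have "(\<lambda>n. qker (S n) h k \<mu>) \<longlonglongrightarrow> (\<Sum>l=0..k. of_bool (l = 0) * poi (k - l) \<mu>)"
    by (simp add: bino_at_0)
  also have "(\<Sum>l=0..k. of_bool (l = 0) * poi (k - l) \<mu> :: real) = (\<Sum>l\<in>{0}. poi (k - l) \<mu>)"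
    by (intro sum.mono_neutral_cong_right) auto
  finally show ?thesis
    by simp
qed

text \<open>Tannery's theorem with the summable majorant \<open>w\<close>. In the application
  \<open>w\<close> is the law \<open>W x y\<close> and \<open>q n\<close> the kernel at time
  \<open>S n\<close>.\<close>

lemma suminf_weighted_tendsto:
  fixes w :: "nat \<Rightarrow> real"
  assumes w: "w sums 1" "\<And>h. 0 \<le> w h"
    and q: "\<And>n h. \<bar>q n h\<bar> \<le> 1" "\<And>h. (\<lambda>n. q n h) \<longlonglongrightarrow> q' h"
  shows "(\<lambda>n. \<Sum>h. w h * q n h) \<longlonglongrightarrow> (\<Sum>h. w h * q' h)"
proof -
  have lim: "(\<lambda>n. w h * q n h) \<longlonglongrightarrow> w h * q' h" for h
    by (intro tendsto_intros q)
  have "norm (w h * q n h) \<le> w h" for n h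
    using mult_left_le[OF q(1) w(2)] w(2) by (simp add: abs_mult)
  then have bound: "eventually (\<lambda>(h, n). norm (w h * q n h) \<le> w h) (at_top \<times>\<^sub>F sequentially)"
    by (intro always_eventually) auto
  show ?thesis
    using tannerys_theorem[OF lim bound] w(1) by (simp add: sums_iff)
qed

lemma suminf_weighted_bounds:
  fixes w :: "nat \<Rightarrow> real"
  assumes "w sums 1" "\<And>h. 0 \<le> w h" "\<And>h. 0 \<le> q h" "\<And>h. q h \<le> 1"
  shows "0 \<le> (\<Sum>h. w h * q h)" "(\<Sum>h. w h * q h) \<le> 1"
proof -
  have *: "w h * q h \<le> w h" for h
    using assms by (intro mult_left_le) auto
  have s: "summable (\<lambda>h. w h * q h)"
    by (rule summable_comparison_test'[of w 0]) (use assms * in \<open>auto simp: sums_iff\<close>)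
  show "0 \<le> (\<Sum>h. w h * q h)"
    by (intro suminf_nonneg s mult_nonneg_nonneg assms)
  have "(\<Sum>h. w h * q h) \<le> (\<Sum>h. w h)"
    using assms(1) by (intro suminf_le s *) (simp add: sums_iff)
  then show "(\<Sum>h. w h * q h) \<le> 1"
    using assms(1) by (simp add: sums_iff)
qed

section \<open>The evolved multigraphons and the Poisson multigraphon\<close>

lemma mg_degree_unit_lebesgue:
  "mg_degree W x = (\<integral>\<^sup>+ y. (\<Sum>l. ennreal (real l * W x y l)) \<partial>unit_lebesgue)"
  by (simp add: mg_degree_def unit_lebesgue_def nn_integral_restrict_space)

lemma mg_rho_unit_lebesgue: "mg_rho W = (\<integral>\<^sup>+ x. mg_degree W x \<partial>unit_lebesgue)"
  by (simp add: mg_rho_def unit_lebesgue_def nn_integral_restrict_space)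

lemma slicewise_measurable_fst_snd:
  "slicewise_measurable W \<Longrightarrow>
     (\<lambda>z. W (fst z) (snd z) l) \<in> borel_measurable (unit_lebesgue \<Otimes>\<^sub>M unit_lebesgue)"
  by (simp add: slicewise_measurable_def case_prod_unfold)

lemma mg_degree_measurable:
  assumes W [THEN slicewise_measurable_fst_snd, measurable]: "slicewise_measurable W"
  shows "mg_degree W \<in> borel_measurable unit_lebesgue"
  unfolding mg_degree_unit_lebesgue[abs_def]
  by (rule unit.borel_measurable_nn_integral) (simp add: case_prod_unfold)

lemma mg_deg_measurable:
  "slicewise_measurable W \<Longrightarrow> mg_deg W \<in> borel_measurable unit_lebesgue"
  using mg_degree_measurable unfolding mg_deg_def[abs_def] by measurable

lemma mg_deg_nonneg: "0 \<le> mg_deg W x"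
  by (simp add: mg_deg_def)

lemma mg_dens_nonneg: "0 \<le> mg_dens W"
  by (simp add: mg_dens_def)

text \<open>One form for all Poisson multigraphons: the weight function \<open>g\<close> is the
  degree function for the common limit \<open>V\<close> and a quantile function for
  \<open>mg_of_distr\<close>.\<close>

definition poisson_mg :: "real \<Rightarrow> (real \<Rightarrow> real) \<Rightarrow> real \<Rightarrow> real \<Rightarrow> nat \<Rightarrow> real" where
  "poisson_mg \<rho> g x y k =
     (if x \<noteq> y then poi k (g x * g y / \<rho>)
      else of_bool (even k) * poi (k div 2) (g x * g y / (2 * \<rho>)))"

lemma mg_of_distr_eq_poisson_mg: "mg_of_distr \<rho> F = poisson_mg \<rho> (quantile F)"
  by (simp add: fun_eq_iff mg_of_distr_def poisson_mg_def)

text \<open>The case split \<open>x \<noteq> y\<close> in \<open>poisson_mg\<close> and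
  \<open>mg_evol\<close> needs a measurable diagonal.\<close>

lemma off_diagonal_measurable [measurable]:
  "(\<lambda>z. fst z \<noteq> snd z) \<in> unit_lebesgue \<Otimes>\<^sub>M unit_lebesgue \<rightarrow>\<^sub>M count_space UNIV"
proof -
  have [measurable]: "fst \<in> borel_measurable (unit_lebesgue \<Otimes>\<^sub>M unit_lebesgue)"
    "snd \<in> borel_measurable (unit_lebesgue \<Otimes>\<^sub>M unit_lebesgue)"
    using measurable_compose[OF measurable_fst id_measurable_unit]
      measurable_compose[OF measurable_snd id_measurable_unit] by auto
  show ?thesis
    by measurable
qed

lemma poisson_mg_measurable:
  assumes [measurable]: "g \<in> borel_measurable unit_lebesgue"
  shows "slicewise_measurable (poisson_mg \<rho> g)"
  unfolding slicewise_measurable_def poisson_mg_def case_prod_unfold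
  by measurable

text \<open>On the diagonal, half of the even multiplicity follows a Poisson law; spreading a series
  over the even indices keeps its sum.\<close>

lemma sums_even:
  assumes "f sums s"
  shows "(\<lambda>k. of_bool (even k) * f (k div 2)) sums (s :: real)"
proof -
  have "(\<lambda>n. of_bool (even (2 * n)) * f (2 * n div 2)) sums s"
    using assms by simp
  then show ?thesis
    by (subst (asm) sums_mono_reindex) (auto simp: strict_mono_def elim: oddE)
qed

lemma multigraphon_poisson_mg:
  assumes "g \<in> borel_measurable unit_lebesgue" "\<And>x. 0 \<le> g x" "0 < \<rho>"
  shows "multigraphon (poisson_mg \<rho> g)"
  unfolding multigraphon_def
proof (intro conjI ballI allI)
  have "(\<lambda>p. case_prod (\<lambda>x y. poisson_mg \<rho> g x y (snd (snd p))) (fst p, fst (snd p)))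
      \<in> borel_measurable (unit_lebesgue \<Otimes>\<^sub>M unit_lebesgue \<Otimes>\<^sub>M count_space UNIV)"
  \<comment> \<open>There are countably many multiplicities, so joint measurability follows from
    measurability for each fixed \<open>l\<close>.\<close>
  proof (rule measurable_compose_countable[where f="\<lambda>l p. case_prod (\<lambda>x y. poisson_mg \<rho> g x y l) (fst p, fst (snd p))"])
    fix l
    have "(\<lambda>(x, y). poisson_mg \<rho> g x y l) \<in> borel_measurable (unit_lebesgue \<Otimes>\<^sub>M unit_lebesgue)"
      using poisson_mg_measurable[OF assms(1)] by (simp add: slicewise_measurable_def)
    moreover have "(\<lambda>p. (fst p, fst (snd p))) \<in> unit_lebesgue \<Otimes>\<^sub>M unit_lebesgue \<Otimes>\<^sub>M count_space UNIV
        \<rightarrow>\<^sub>M unit_lebesgue \<Otimes>\<^sub>M unit_lebesgue"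
      by measurable
    ultimately show "(\<lambda>p. case_prod (\<lambda>x y. poisson_mg \<rho> g x y l) (fst p, fst (snd p)))
      \<in> borel_measurable (unit_lebesgue \<Otimes>\<^sub>M unit_lebesgue \<Otimes>\<^sub>M count_space UNIV)"
      using measurable_compose by blast
  qed measurable
  then show "(\<lambda>(x, y, l). poisson_mg \<rho> g x y l) \<in> borel_measurable
        (restrict_space borel {0..1} \<Otimes>\<^sub>M restrict_space borel {0..1} \<Otimes>\<^sub>M count_space UNIV)"
    by (subst (asm) measurable_cong_sets[OF _ refl, where M'="restrict_space borel {0..1}
          \<Otimes>\<^sub>M restrict_space borel {0..1} \<Otimes>\<^sub>M count_space UNIV"])
       (auto intro!: sets_pair_measure_cong sets_unit_lebesgue simp: case_prod_unfold)
  fix x y :: real and l :: nat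
  have *: "0 \<le> g x * g y / \<rho>" "0 \<le> g x * g y / (2 * \<rho>)"
    using assms by auto
  show "0 \<le> poisson_mg \<rho> g x y l" "poisson_mg \<rho> g x y l \<le> 1"
    using poi_nonneg poi_le_1 * by (auto simp: poisson_mg_def)
  show "poisson_mg \<rho> g x y l = poisson_mg \<rho> g y x l"
    by (simp add: poisson_mg_def mult.commute)
  show "poisson_mg \<rho> g x x (2 * l + 1) = 0"
    by (simp add: poisson_mg_def)
  show "poisson_mg \<rho> g x y sums 1"
    unfolding poisson_mg_def using poi_sums sums_even[OF poi_sums] by (cases "x = y") auto
qed

section \<open>Limits of the evolved multigraphons\<close>

lemma mg_evol_measurable:
  assumes W: "slicewise_measurable W"
  shows "slicewise_measurable (mg_evol W t)"
proof -
  note [measurable] = slicewise_measurable_fst_snd[OF W] mg_deg_measurable[OF W]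
  show ?thesis
    unfolding slicewise_measurable_def mg_evol_def case_prod_unfold
    by measurable
qed

lemma mg_evol_bounded:
  assumes W: "multigraphon W" and "t > 0"
  shows "unit_bounded (mg_evol W t)"
  unfolding unit_bounded_def
proof (intro ballI allI)
  fix x y :: real and k :: nat
  assume xy: "x \<in> {0..1}" "y \<in> {0..1}"
  have w: "(\<lambda>h. W x y h) sums 1" "\<And>h. 0 \<le> W x y h"
    using W xy by (auto simp: multigraphon_def)
  have \<mu>: "0 \<le> mg_deg W x * mg_deg W y / mg_dens W" "0 \<le> mg_deg W x * mg_deg W y / (2 * mg_dens W)"
    using mg_deg_nonneg mg_dens_nonneg by auto
  show "0 \<le> mg_evol W t x y k \<and> mg_evol W t x y k \<le> 1"
    unfolding mg_evol_def
    using suminf_weighted_bounds[OF w qker_bounds[OF \<open>t > 0\<close> \<mu>(1)]]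
      suminf_weighted_bounds[OF w qker_bounds[OF \<open>t > 0\<close> \<mu>(2)]]
    by auto
qed

text \<open>Common part of both time limits. The kernel limit \<open>Q\<close> passes through the
  series over \<open>h\<close> by \<open>suminf_weighted_tendsto\<close> and through the integral by
  \<open>mg_tendsto_pointwise\<close>; it remains to recognise the limiting series as
  \<open>V\<close>, on and off the diagonal.\<close>

lemma mg_evol_tendsto_aux:
  assumes W: "multigraphon W" and V: "slicewise_measurable V"
    and S: "\<And>n. S n > 0" "\<And>h k \<mu>. (\<lambda>n. qker (S n) h k \<mu>) \<longlonglongrightarrow> Q h k \<mu>"
    and off: "\<And>x y k. x \<in> {0..1} \<Longrightarrow> y \<in> {0..1} \<Longrightarrow> x \<noteq> y \<Longrightarrow>
        V x y k = (\<Sum>h. W x y h * Q h k (mg_deg W x * mg_deg W y / mg_dens W))"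
    and diag: "\<And>x k. x \<in> {0..1} \<Longrightarrow>
        V x x k = of_bool (even k) *
          (\<Sum>h. W x x h * Q (h div 2) (k div 2) (mg_deg W x * mg_deg W x / (2 * mg_dens W)))"
  shows "mg_tendsto (\<lambda>n. mg_evol W (S n)) V sequentially"
proof (rule mg_tendsto_pointwise)
  fix n
  show "slicewise_measurable (mg_evol W (S n))"
    by (intro mg_evol_measurable multigraphon_slicewise_measurable W)
  show "unit_bounded (mg_evol W (S n))"
    by (intro mg_evol_bounded W S)
next
  fix x y :: real and k :: nat
  assume xy: "x \<in> {0..1}" "y \<in> {0..1}"
  have w: "(\<lambda>h. W x y h) sums 1" "\<And>h. 0 \<le> W x y h"
    using W xy by (auto simp: multigraphon_def)
  define \<mu> where "\<mu> = mg_deg W x * mg_deg W y / mg_dens W"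
  define \<nu> where "\<nu> = mg_deg W x * mg_deg W y / (2 * mg_dens W)"
  have nonneg: "0 \<le> \<mu>" "0 \<le> \<nu>"
    unfolding \<mu>_def \<nu>_def using mg_deg_nonneg mg_dens_nonneg by auto
  have q: "\<bar>qker (S n) h k a\<bar> \<le> 1" if "0 \<le> a" for n h k a
    using qker_bounds[OF S(1) that] by (simp add: abs_of_nonneg)
  show "(\<lambda>n. mg_evol W (S n) x y k) \<longlonglongrightarrow> V x y k"
  proof (cases "x = y")
    case False
    then show ?thesis
      using suminf_weighted_tendsto[OF w q[OF nonneg(1)] S(2)] off[OF xy False]
      by (simp add: mg_evol_def \<mu>_def)
  next
    case True
    have "(\<lambda>n. of_bool (even k) * (\<Sum>h. W x y h * qker (S n) (h div 2) (k div 2) \<nu>)) \<longlonglongrightarrow>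
        of_bool (even k) * (\<Sum>h. W x y h * Q (h div 2) (k div 2) \<nu>)"
      by (intro tendsto_intros suminf_weighted_tendsto w q nonneg S(2))
    then show ?thesis
      using True diag[OF xy(1)] by (simp add: mg_evol_def \<nu>_def)
  qed
qed (rule V)

lemma mg_evol_tendsto_start:
  assumes W: "multigraphon W"
  shows "mg_tendsto (mg_evol W) W (at_right 0)"
proof (rule mg_tendsto_at_right_0)
  fix S :: "nat \<Rightarrow> real"
  assume S: "\<And>n. S n > 0" "S \<longlonglongrightarrow> 0"
  show "mg_tendsto (\<lambda>n. mg_evol W (S n)) W sequentially"
  proof (rule mg_evol_tendsto_aux[OF W multigraphon_slicewise_measurable[OF W] S(1)
        qker_tendsto_0[OF S(2)]])
    fix x y :: real and k :: nat
    assume "x \<in> {0..1}"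
    have "(\<Sum>h. W x y h * of_bool (h = k)) = (\<Sum>h\<in>{k}. W x y h * of_bool (h = k))"
      by (rule suminf_finite) auto
    then show "W x y k = (\<Sum>h. W x y h * of_bool (h = k))"
      by simp
    show "W x x k = of_bool (even k) * (\<Sum>h. W x x h * of_bool (h div 2 = k div 2))"
    proof (cases "even k")
      case False
      then show ?thesis
        using W \<open>x \<in> {0..1}\<close> by (auto simp: multigraphon_def elim!: oddE)
    next
      case True
      then obtain j where j: "k = 2 * j" by (elim evenE)
      \<comment> \<open>For even \<open>k\<close> both \<open>h = k\<close> and
        \<open>h = Suc k\<close> satisfy \<open>h div 2 = k div 2\<close>; the second is odd and
        carries no mass on the diagonal.\<close>
      have "W x x (Suc k) = 0"
        using W \<open>x \<in> {0..1}\<close> by (auto simp: multigraphon_def j)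
      moreover have "(\<Sum>h. W x x h * of_bool (h div 2 = k div 2))
          = (\<Sum>h\<in>{k, Suc k}. W x x h * of_bool (h div 2 = k div 2))"
        by (rule suminf_finite) (auto simp: j)
      ultimately show ?thesis
        by (simp add: j)
    qed
  qed
qed

text \<open>The limiting kernel no longer depends on \<open>h\<close>, so the weights
  \<open>W x y h\<close> add up to 1 and only the Poisson factor is left.\<close>

lemma mg_evol_tendsto_infinity:
  assumes W: "multigraphon W"
  shows "mg_tendsto (mg_evol W) (poisson_mg (mg_dens W) (mg_deg W)) at_top"
proof (rule mg_tendsto_at_top)
  fix S :: "nat \<Rightarrow> real"
  assume S: "\<And>n. S n > 0" "filterlim S at_top sequentially"
  have W': "slicewise_measurable W"
    by (rule multigraphon_slicewise_measurable[OF W])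
  show "mg_tendsto (\<lambda>n. mg_evol W (S n)) (poisson_mg (mg_dens W) (mg_deg W)) sequentially"
  proof (rule mg_evol_tendsto_aux[OF W poisson_mg_measurable[OF mg_deg_measurable[OF W']] S(1)
        qker_tendsto_infinity[OF S(2)]])
    fix x y :: real and k :: nat
    have sum: "(\<Sum>h. W x y h * c) = c" if "x \<in> {0..1}" "y \<in> {0..1}" for c y
    proof -
      have "(\<lambda>h. W x y h) sums 1"
        using W that by (simp add: multigraphon_def)
      from sums_mult2[OF this, of c] show ?thesis
        by (simp add: sums_iff)
    qed
    show "poisson_mg (mg_dens W) (mg_deg W) x y k =
         (\<Sum>h. W x y h * poi k (mg_deg W x * mg_deg W y / mg_dens W))"
      if "x \<in> {0..1}" "y \<in> {0..1}" "x \<noteq> y"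
      using that sum by (simp add: poisson_mg_def)
    show "poisson_mg (mg_dens W) (mg_deg W) x x k = of_bool (even k) *
         (\<Sum>h. W x x h * poi (k div 2) (mg_deg W x * mg_deg W x / (2 * mg_dens W)))"
      if "x \<in> {0..1}"
      using that sum by (simp add: poisson_mg_def)
  qed
qed

section \<open>Finiteness of the edge density\<close>

lemma sum_square_split:
  fixes f :: "nat \<Rightarrow> nat \<Rightarrow> real"
  assumes "\<And>i j. i \<in> {1..n} \<Longrightarrow> j \<in> {1..n} \<Longrightarrow> f i j = f j i"
  shows "(\<Sum>i=1..n. \<Sum>j=1..n. f i j) =
         2 * (\<Sum>(i, j)\<in>{(i, j). 1 \<le> i \<and> i < j \<and> j \<le> n}. f i j) + (\<Sum>i=1..n. f i i)"
proof -
  let ?L = "{(i, j). 1 \<le> i \<and> i < j \<and> j \<le> n}" and ?U = "{(i, j). 1 \<le> j \<and> j < i \<and> i \<le> n}"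
  let ?D = "(\<lambda>i. (i, i)) ` {1..n}"
  have fin: "finite ?L" "finite ?U"
    by (rule finite_subset[of _ "{1..n} \<times> {1..n}"]; auto)+
  have "(\<Sum>i=1..n. \<Sum>j=1..n. f i j) = (\<Sum>(i, j)\<in>{1..n} \<times> {1..n}. f i j)"
    by (rule sum.cartesian_product)
  also have "{1..n} \<times> {1..n} = ?L \<union> ?U \<union> ?D"
    by (auto simp: image_iff)
  also have "(\<Sum>(i, j)\<in>?L \<union> ?U \<union> ?D. f i j) =
      (\<Sum>(i, j)\<in>?L. f i j) + (\<Sum>(i, j)\<in>?U. f i j) + (\<Sum>(i, j)\<in>?D. f i j)"
    using fin by (subst sum.union_disjoint; (subst sum.union_disjoint)?) auto
  also have "(\<Sum>(i, j)\<in>?U. f i j) = (\<Sum>(i, j)\<in>?L. f i j)"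
    by (rule sum.reindex_bij_witness[of _ prod.swap prod.swap]) (auto intro: assms)
  also have "(\<Sum>(i, j)\<in>?D. f i j) = (\<Sum>i=1..n. f i i)"
    by (subst sum.reindex) (auto simp: inj_on_def)
  finally show ?thesis by simp
qed

text \<open>Exponential moments bound the mean since \<open>x \<le> exp x\<close>. Each unordered
  pair counts twice, and \<open>2 * (n choose 2) + n\<close> is exactly \<open>n^2\<close>.\<close>

lemma sum_adj_mat_le:
  fixes b :: "nat \<Rightarrow> nat \<Rightarrow> nat"
  assumes b: "b \<in> adj_mats n" and "n \<ge> 2" "lam > 0"
    and off: "1 / real (n choose 2) * (\<Sum>(i, j)\<in>{(i, j). 1 \<le> i \<and> i < j \<and> j \<le> n}.
             exp (lam * real (b i j))) \<le> C"
    and diag: "1 / real n * (\<Sum>i=1..n. exp (lam * real (b i i))) \<le> C"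
  shows "(\<Sum>i=1..n. \<Sum>j=1..n. real (b i j)) \<le> C / lam * real n ^ 2"
proof -
  have choose2: "2 * real (n choose 2) = real n * (real n - 1)"
    using \<open>n \<ge> 2\<close> by (simp add: choose_two real_of_nat_div of_nat_diff)
  have "n choose 2 > 0"
    using \<open>n \<ge> 2\<close> by (simp add: zero_less_binomial_iff)
  then have off': "(\<Sum>(i, j)\<in>{(i, j). 1 \<le> i \<and> i < j \<and> j \<le> n}. exp (lam * real (b i j)))
      \<le> C * real (n choose 2)"
    using off by (simp add: field_simps)
  have diag': "(\<Sum>i=1..n. exp (lam * real (b i i))) \<le> C * real n"
    using diag \<open>n \<ge> 2\<close> by (simp add: field_simps)
  have le: "lam * m \<le> exp (lam * m)" for m
    using exp_ge_add_one_self[of "lam * m"] by linarith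
  have "lam * (\<Sum>i=1..n. \<Sum>j=1..n. real (b i j)) = (\<Sum>i=1..n. \<Sum>j=1..n. lam * real (b i j))"
    by (simp add: sum_distrib_left)
  also have "\<dots> \<le> (\<Sum>i=1..n. \<Sum>j=1..n. exp (lam * real (b i j)))"
    by (intro sum_mono le)
  also have "\<dots> = 2 * (\<Sum>(i, j)\<in>{(i, j). 1 \<le> i \<and> i < j \<and> j \<le> n}. exp (lam * real (b i j)))
      + (\<Sum>i=1..n. exp (lam * real (b i i)))"
    using b by (intro sum_square_split) (auto simp: adj_mats_def)
  also have "\<dots> \<le> C * (2 * real (n choose 2)) + C * real n"
    using off' diag' by linarith
  also have "\<dots> = C * real n ^ 2"
    unfolding choose2 by (simp add: power2_eq_square algebra_simps)
  finally show ?thesis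
    using \<open>lam > 0\<close> by (simp add: field_simps)
qed

text \<open>Up to values outside the index range, \<open>adj_mats 2\<close> consists of the matrices
  \<open>mat2 (2 * a) l (2 * c)\<close>. Summing their densities over \<open>a\<close> and
  \<open>c\<close> leaves the law of the multiplicity \<open>l\<close> between two random
  vertices.\<close>

definition mat2 :: "nat \<Rightarrow> nat \<Rightarrow> nat \<Rightarrow> nat \<Rightarrow> nat \<Rightarrow> nat" where
  "mat2 a l b i j = (if i = j then if i = 1 then a else b else l)"

lemma mat2_adj_mats: "mat2 (2 * a) l (2 * b) \<in> adj_mats 2"
  by (auto simp: adj_mats_def mat2_def)

lemma atLeastAtMost_1_2: "{1..2} = {1, 2 :: nat}"
  by auto

lemma sum_delta_le_1: "(\<Sum>a<N. of_bool (c = 2 * a)) \<le> (1 :: real)" for c :: nat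
proof -
  have "(\<Sum>a<N. of_bool (c = 2 * a)) \<le> (\<Sum>a<N. of_bool (a = c div 2) :: real)"
    by (intro sum_mono) auto
  also have "\<dots> \<le> 1"
    by (simp add: of_bool_def)
  finally show ?thesis .
qed

text \<open>A map \<phi> matches at most one triple \<open>(a, c, l)\<close>, and then
  \<open>l\<close> is the multiplicity between its two values. The sum is therefore at most the mean
  multiplicity. Truncation at \<open>N\<close> leaves finitely many densities, so that the bound can
  pass to the limit in \<open>n\<close>.\<close>

lemma weighted_t_eq_mat_le:
  fixes b :: "nat \<Rightarrow> nat \<Rightarrow> nat"
  assumes "(\<Sum>i=1..n. \<Sum>j=1..n. real (b i j)) \<le> K * real n ^ 2" "n \<ge> 1"
  shows "(\<Sum>a<N. \<Sum>c<N. \<Sum>l<N. real l * t_eq_mat 2 (mat2 (2 * a) l (2 * c)) n b) \<le> K"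
proof -
  let ?F = "{1..2 :: nat} \<rightarrow>\<^sub>E {1..n}"
  have pointwise: "(\<Sum>a<N. \<Sum>c<N. \<Sum>l<N. real l *
      of_bool (\<forall>i\<in>{1..2}. \<forall>j\<in>{1..2}. mat2 (2 * a) l (2 * c) i j = b (\<phi> i) (\<phi> j)))
      \<le> real (b (\<phi> 1) (\<phi> 2))" (is "?lhs \<le> ?d") for \<phi> :: "nat \<Rightarrow> nat"
  proof -
    \<comment> \<open>Replacing \<open>l\<close> by the multiplicity \<open>?d\<close> and weakening
      the match to three separate conditions makes the triple sum a product.\<close>
    have "?lhs \<le> (\<Sum>a<N. \<Sum>c<N. \<Sum>l<N. of_bool (b (\<phi> 1) (\<phi> 1) = 2 * a) *
        (of_bool (b (\<phi> 2) (\<phi> 2) = 2 * c) * (?d * of_bool (l = b (\<phi> 1) (\<phi> 2)))))"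
    proof (intro sum_mono)
      fix a c l
      show "real l * of_bool (\<forall>i\<in>{1..2}. \<forall>j\<in>{1..2}. mat2 (2 * a) l (2 * c) i j = b (\<phi> i) (\<phi> j))
          \<le> of_bool (b (\<phi> 1) (\<phi> 1) = 2 * a) *
            (of_bool (b (\<phi> 2) (\<phi> 2) = 2 * c) * (?d * of_bool (l = b (\<phi> 1) (\<phi> 2))))"
      proof (cases "\<forall>i\<in>{1..2}. \<forall>j\<in>{1..2}. mat2 (2 * a) l (2 * c) i j = b (\<phi> i) (\<phi> j)")
        case True
        then have "b (\<phi> 1) (\<phi> 1) = 2 * a" "b (\<phi> 2) (\<phi> 2) = 2 * c" "b (\<phi> 1) (\<phi> 2) = l"
          using bspec[OF bspec[OF True, of 1], of 1] bspec[OF bspec[OF True, of 2], of 2]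
            bspec[OF bspec[OF True, of 1], of 2] by (simp_all add: mat2_def)
        then show ?thesis by simp
      next
        case False
        then show ?thesis by (simp only: of_bool_def if_False) simp
      qed
    qed
    also have "\<dots> = (\<Sum>a<N. of_bool (b (\<phi> 1) (\<phi> 1) = 2 * a)) *
        ((\<Sum>c<N. of_bool (b (\<phi> 2) (\<phi> 2) = 2 * c)) * (\<Sum>l<N. ?d * of_bool (l = b (\<phi> 1) (\<phi> 2))))"
      by (simp only: sum_distrib_left[symmetric] sum_distrib_right[symmetric])
    also have "\<dots> \<le> 1 * (1 * (?d * 1))"
    proof -
      have "(\<Sum>l<N. of_bool (l = b (\<phi> 1) (\<phi> 2))) \<le> (1 :: real)"
        by (simp add: of_bool_def)
      then show ?thesis
        unfolding sum_distrib_left[symmetric]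
        by (intro mult_mono sum_delta_le_1 mult_nonneg_nonneg sum_nonneg) auto
    qed
    finally show ?thesis by simp
  qed
  have "(\<Sum>a<N. \<Sum>c<N. \<Sum>l<N. real l * t_eq_mat 2 (mat2 (2 * a) l (2 * c)) n b) =
      1 / real n ^ 2 * (\<Sum>\<phi>\<in>?F. \<Sum>a<N. \<Sum>c<N. \<Sum>l<N. real l *
      of_bool (\<forall>i\<in>{1..2}. \<forall>j\<in>{1..2}. mat2 (2 * a) l (2 * c) i j = b (\<phi> i) (\<phi> j)))"
  proof -
    have swap: "(\<Sum>\<phi>\<in>?F. \<Sum>a<N. \<Sum>c<N. \<Sum>l<N. g \<phi> a c l) =
        (\<Sum>a<N. \<Sum>c<N. \<Sum>l<N. \<Sum>\<phi>\<in>?F. g \<phi> a c l)" for g :: "_ \<Rightarrow> _ \<Rightarrow> _ \<Rightarrow> _ \<Rightarrow> real"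
    proof -
      have "(\<Sum>\<phi>\<in>?F. \<Sum>a<N. \<Sum>c<N. \<Sum>l<N. g \<phi> a c l) =
          (\<Sum>a<N. \<Sum>\<phi>\<in>?F. \<Sum>c<N. \<Sum>l<N. g \<phi> a c l)"
        by (rule sum.swap)
      also have "\<dots> = (\<Sum>a<N. \<Sum>c<N. \<Sum>\<phi>\<in>?F. \<Sum>l<N. g \<phi> a c l)"
        by (intro sum.cong refl sum.swap)
      also have "\<dots> = (\<Sum>a<N. \<Sum>c<N. \<Sum>l<N. \<Sum>\<phi>\<in>?F. g \<phi> a c l)"
        by (intro sum.cong refl sum.swap)
      finally show ?thesis .
    qed
    show ?thesis
      unfolding t_eq_mat_def swap sum_distrib_left
      by (intro sum.cong refl) (rule mult.left_commute)
  qed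
  also have "\<dots> \<le> 1 / real n ^ 2 * (\<Sum>\<phi>\<in>?F. real (b (\<phi> 1) (\<phi> 2)))"
    by (intro mult_left_mono sum_mono pointwise) auto
  also have "(\<Sum>\<phi>\<in>?F. real (b (\<phi> 1) (\<phi> 2))) = (\<Sum>(i, j)\<in>{1..n} \<times> {1..n}. real (b i j))"
    by (rule sum.reindex_bij_witness[where
          i = "\<lambda>(i, j) k. if k = 1 then i else if k = 2 then j else undefined" and
          j = "\<lambda>\<phi>. (\<phi> 1, \<phi> 2)"])
       (auto simp: PiE_iff extensional_def fun_eq_iff atLeastAtMost_1_2)
  also have "\<dots> = (\<Sum>i=1..n. \<Sum>j=1..n. real (b i j))"
    by (rule sum.cartesian_product[symmetric])
  also have "1 / real n ^ 2 * \<dots> \<le> 1 / real n ^ 2 * (K * real n ^ 2)"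
    by (intro mult_left_mono assms) auto
  finally show ?thesis
    using \<open>n \<ge> 1\<close> by simp
qed

section \<open>Passage from the matrices to the multigraphon\<close>

lemma t_eq_mat2:
  "t_eq 2 (mat2 a l b) W = (\<integral>x. W (x 1) (x 1) a * W (x 2) (x 2) b * W (x 1) (x 2) l \<partial>cube_measure 2)"
proof -
  have "{1..2} = {1, 2 :: nat}" "{Suc 0..2} = {1, 2}" "{2..2} = {2 :: nat}"
    by auto
  then show ?thesis
    unfolding t_eq_unit_lebesgue by (simp add: mat2_def mult_ac)
qed

text \<open>Fatou's lemma. \<open>F N\<close> is the integrand of the truncated weighted sum of
  densities; as \<open>N\<close> grows the loop masses \<open>P\<close> tend to 1, so its lower
  limit dominates the multiplicity series whose integral is \<open>mg_rho W\<close>.\<close>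

lemma mg_rho_le:
  assumes W: "multigraphon W"
    and bound: "\<And>N. (\<Sum>a<N. \<Sum>c<N. \<Sum>l<N. real l * t_eq 2 (mat2 (2 * a) l (2 * c)) W) \<le> K"
  shows "mg_rho W \<le> ennreal K"
proof -
  define P where "P x N = (\<Sum>a<N. W x x (2 * a))" for x and N :: nat
  define S where "S x y N = (\<Sum>l<N. real l * W x y l)" for x y and N :: nat
  define F where "F N x = P (x 1) N * (P (x 2) N * S (x 1) (x 2) N)" for N and x :: "nat \<Rightarrow> real"
  have sl: "slicewise_measurable W" and ub: "unit_bounded W"
    using W multigraphon_slicewise_measurable multigraphon_unit_bounded by auto
  have W_meas [measurable]: "(\<lambda>x. W (x i) (x j) l) \<in> borel_measurable (cube_measure 2)"
    if "i \<in> {1..2}" "j \<in> {1..2}" for i j l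
    by (intro slicewise_measurable_comp[OF sl] measurable_component_singleton that)
  have coord: "x 1 \<in> {0..1} \<and> x 2 \<in> {0..1}" if "x \<in> space (cube_measure 2)" for x
    using cube_coordinate[OF that, of 1] cube_coordinate[OF that, of 2] by auto
  have W01: "0 \<le> W x y l" "W x y l \<le> 1" if "x \<in> {0..1}" "y \<in> {0..1}" for x y l
    using ub that by (auto simp: unit_bounded_def)
  have int: "integrable (cube_measure 2)
      (\<lambda>x. W (x 1) (x 1) a * W (x 2) (x 2) b * W (x 1) (x 2) l)" for a b l
  proof (rule cube.integrable_const_bound[of _ 1])
    show "AE x in cube_measure 2. norm (W (x 1) (x 1) a * W (x 2) (x 2) b * W (x 1) (x 2) l) \<le> 1"
    proof (rule AE_I2)
      fix x assume "x \<in> space (cube_measure 2)"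
      then show "norm (W (x 1) (x 1) a * W (x 2) (x 2) b * W (x 1) (x 2) l) \<le> 1"
        using coord[of x] W01[of "x 1" "x 1"] W01[of "x 2" "x 2"] W01[of "x 1" "x 2"]
        by (auto simp: abs_mult abs_of_nonneg intro!: mult_le_one)
    qed
  qed measurable
  have F_expand: "F N x = (\<Sum>a<N. \<Sum>c<N. \<Sum>l<N.
      real l * (W (x 1) (x 1) (2 * a) * W (x 2) (x 2) (2 * c) * W (x 1) (x 2) l))" for N x
  proof -
    have "F N x = (\<Sum>a<N. \<Sum>c<N. \<Sum>l<N.
        W (x 1) (x 1) (2 * a) * (W (x 2) (x 2) (2 * c) * (real l * W (x 1) (x 2) l)))"
      unfolding F_def P_def S_def
      by (simp only: sum_distrib_left[symmetric] sum_distrib_right[symmetric])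
    then show ?thesis
      by (simp only: mult_ac)
  qed
  have F_int: "integrable (cube_measure 2) (F N)" for N
    unfolding F_expand[abs_def]
    by (intro Bochner_Integration.integrable_sum integrable_mult_right int)
  have F_nonneg: "0 \<le> F N x" if "x \<in> space (cube_measure 2)" for N x
    unfolding F_def P_def S_def using coord[OF that] W01
    by (auto intro!: mult_nonneg_nonneg sum_nonneg)
  have F_le: "(\<integral>\<^sup>+x. ennreal (F N x) \<partial>cube_measure 2) \<le> ennreal K" for N
  proof -
    have "(\<integral>x. F N x \<partial>cube_measure 2) =
        (\<Sum>a<N. \<Sum>c<N. \<Sum>l<N. real l * t_eq 2 (mat2 (2 * a) l (2 * c)) W)"
      unfolding F_expand t_eq_mat2
      by (subst Bochner_Integration.integral_sum,
          (intro Bochner_Integration.integrable_sum integrable_mult_right int; fail),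
          intro sum.cong refl)+ (rule integral_mult_right_zero)
    then show ?thesis
      using bound[of N] F_nonneg F_int[of N]
      by (subst nn_integral_eq_integral) (auto intro: ennreal_leI)
  qed
  \<comment> \<open>The truncation \<open>L\<close> of the multiplicity series stays fixed while the
    loop masses tend to 1, so a divergent series needs no separate treatment.\<close>
  have S_le: "(\<Sum>l. ennreal (real l * W (x 1) (x 2) l)) \<le> liminf (\<lambda>N. ennreal (F N x))"
    if x: "x \<in> space (cube_measure 2)" for x
  proof (rule suminf_le_const)
    fix L
    \<comment> \<open>Odd loop counts have no mass, so the even ones carry all of it.\<close>
    have P_lim: "(\<lambda>N. P z N) \<longlonglongrightarrow> 1" if z: "z \<in> {0..1}" for z
    proof -
      have odd0: "W z z h = 0" if "h \<notin> range ((*) 2)" for h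
      proof -
        have "odd h" using that by (auto elim!: evenE)
        then show ?thesis using W z by (auto simp: multigraphon_def elim!: oddE)
      qed
      have "(\<lambda>h. W z z h) sums 1"
        using W z by (simp add: multigraphon_def)
      then have "(\<lambda>a. W z z (2 * a)) sums 1"
        by (subst sums_mono_reindex) (auto simp: strict_mono_def odd0)
      then show ?thesis
        by (simp add: sums_def P_def)
    qed
    have "(\<lambda>N. P (x 1) N * (P (x 2) N * S (x 1) (x 2) L)) \<longlonglongrightarrow> 1 * (1 * S (x 1) (x 2) L)"
      using coord[OF x] by (intro tendsto_intros P_lim) auto
    then have lim: "(\<lambda>N. ennreal (P (x 1) N * (P (x 2) N * S (x 1) (x 2) L))) \<longlonglongrightarrow> ennreal (S (x 1) (x 2) L)"
      by (intro tendsto_ennrealI) simp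
    have ev: "\<forall>\<^sub>F N in sequentially. ennreal (P (x 1) N * (P (x 2) N * S (x 1) (x 2) L)) \<le> ennreal (F N x)"
      using eventually_ge_at_top[of L]
    proof eventually_elim
      case (elim N)
      have "S (x 1) (x 2) L \<le> S (x 1) (x 2) N"
        unfolding S_def using elim coord[OF x] W01 by (intro sum_mono2) auto
      then show ?case
        unfolding F_def P_def using coord[OF x] W01
        by (intro ennreal_leI mult_left_mono sum_nonneg) auto
    qed
    have "(\<Sum>l<L. ennreal (real l * W (x 1) (x 2) l)) = ennreal (S (x 1) (x 2) L)"
      unfolding S_def using coord[OF x] W01 by (intro sum_ennreal) auto
    also have "\<dots> = liminf (\<lambda>N. ennreal (P (x 1) N * (P (x 2) N * S (x 1) (x 2) L)))"
      using lim_imp_Liminf[OF _ lim] by simp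
    also have "\<dots> \<le> liminf (\<lambda>N. ennreal (F N x))"
      by (rule Liminf_mono[OF ev])
    finally show "(\<Sum>l<L. ennreal (real l * W (x 1) (x 2) l)) \<le> liminf (\<lambda>N. ennreal (F N x))" .
  qed simp
  have [measurable]: "(\<lambda>z. W (fst z) (snd z) l) \<in> borel_measurable (unit_lebesgue \<Otimes>\<^sub>M unit_lebesgue)" for l
    by (rule slicewise_measurable_fst_snd[OF sl])
  have "mg_rho W = (\<integral>\<^sup>+z. (\<Sum>l. ennreal (real l * W (fst z) (snd z) l)) \<partial>(unit_lebesgue \<Otimes>\<^sub>M unit_lebesgue))"
    unfolding mg_rho_unit_lebesgue mg_degree_unit_lebesgue
    by (subst unit.nn_integral_fst[symmetric]) auto
  also have "\<dots> = (\<integral>\<^sup>+x. (\<Sum>l. ennreal (real l * W (x 1) (x 2) l)) \<partial>(\<Pi>\<^sub>M i\<in>{1, 2 :: nat}. unit_lebesgue))"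
    by (rule cube.product_nn_integral_pair[symmetric]) (auto simp: case_prod_unfold)
  also have "\<dots> \<le> (\<integral>\<^sup>+x. liminf (\<lambda>N. ennreal (F N x)) \<partial>cube_measure 2)"
    unfolding atLeastAtMost_1_2[symmetric] by (intro nn_integral_mono S_le)
  also have "\<dots> \<le> liminf (\<lambda>N. \<integral>\<^sup>+x. ennreal (F N x) \<partial>cube_measure 2)"
    using F_int by (intro nn_integral_liminf) auto
  also have "\<dots> \<le> liminf (\<lambda>N :: nat. ennreal K)"
    by (intro Liminf_mono always_eventually allI F_le)
  also have "\<dots> = ennreal K"
    by (simp add: Liminf_const)
  finally show ?thesis .
qed

text \<open>The mean multiplicity of \<open>B n\<close> is at most \<open>C / lam\<close> for
  \<open>n \<ge> 2\<close>. The bound survives the convergence of finitely many densities, and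
  Fatou's lemma removes the truncation.\<close>

lemma mg_rho_finite:
  fixes B :: "nat \<Rightarrow> nat \<Rightarrow> nat \<Rightarrow> nat"
  assumes "multigraphon W" "\<And>n. n \<ge> 1 \<Longrightarrow> B n \<in> adj_mats n" "mats_tendsto B W" "lam > 0"
    and "\<And>n. n \<ge> 2 \<Longrightarrow>
           1 / real (n choose 2) * (\<Sum>(i, j)\<in>{(i, j). 1 \<le> i \<and> i < j \<and> j \<le> n}.
             exp (lam * real (B n i j))) \<le> C"
    and "\<And>n. n \<ge> 1 \<Longrightarrow> 1 / real n * (\<Sum>i=1..n. exp (lam * real (B n i i))) \<le> C"
  shows "mg_rho W < \<infinity>"
proof -
  have "(\<Sum>a<N. \<Sum>c<N. \<Sum>l<N. real l * t_eq 2 (mat2 (2 * a) l (2 * c)) W) \<le> C / lam" for N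
  proof (rule LIMSEQ_le_const2)
    show "(\<lambda>n. \<Sum>a<N. \<Sum>c<N. \<Sum>l<N. real l * t_eq_mat 2 (mat2 (2 * a) l (2 * c)) n (B n)) \<longlonglongrightarrow>
        (\<Sum>a<N. \<Sum>c<N. \<Sum>l<N. real l * t_eq 2 (mat2 (2 * a) l (2 * c)) W)"
      using assms(3) mat2_adj_mats by (intro tendsto_intros) (auto simp: mats_tendsto_def)
    show "\<exists>M. \<forall>n\<ge>M. (\<Sum>a<N. \<Sum>c<N. \<Sum>l<N.
        real l * t_eq_mat 2 (mat2 (2 * a) l (2 * c)) n (B n)) \<le> C / lam"
      by (intro exI[of _ 2] allI impI weighted_t_eq_mat_le sum_adj_mat_le assms) auto
  qed
  from mg_rho_le[OF assms(1) this] show ?thesis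
    by (simp add: order.strict_trans1)
qed

section \<open>Poisson densities as functionals of a distribution\<close>

text \<open>Absolute values keep the integrand bounded when a coordinate is negative on a null set.\<close>

definition poisson_integrand ::
  "nat \<Rightarrow> (nat \<Rightarrow> nat \<Rightarrow> nat) \<Rightarrow> real \<Rightarrow> (nat \<Rightarrow> real) \<Rightarrow> real" where
  "poisson_integrand k A \<rho> x =
     (\<Prod>i\<in>{1..k}. \<Prod>j\<in>{i..k}.
        if i \<noteq> j then poi (A i j) (\<bar>x i\<bar> * \<bar>x j\<bar> / \<rho>)
        else of_bool (even (A i j)) * poi (A i j div 2) (\<bar>x i\<bar> * \<bar>x j\<bar> / (2 * \<rho>)))"

text \<open>Expectation over \<open>k\<close> independent weights with law \<open>M\<close>; a
  weight function enters through its law alone.\<close>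

definition poisson_density ::
  "nat \<Rightarrow> (nat \<Rightarrow> nat \<Rightarrow> nat) \<Rightarrow> real \<Rightarrow> real measure \<Rightarrow> real" where
  "poisson_density k A \<rho> M = (\<integral>x. poisson_integrand k A \<rho> x \<partial>(\<Pi>\<^sub>M i\<in>{1..k}. M))"

lemma poisson_integrand_measurable:
  assumes "sets M = sets borel"
  shows "poisson_integrand k A \<rho> \<in> borel_measurable (\<Pi>\<^sub>M i\<in>{1..k}. M)"
proof -
  have comp: "(\<lambda>x. x i) \<in> borel_measurable (\<Pi>\<^sub>M i\<in>{1..k}. M)" if "i \<in> {1..k}" for i
    using measurable_component_singleton[OF that, of "\<lambda>_. M"]
    by (simp add: measurable_cong_sets[OF refl assms])
  have poi': "(\<lambda>x. poi c (\<bar>x i\<bar> * \<bar>x j\<bar> / d)) \<in> borel_measurable (\<Pi>\<^sub>M i\<in>{1..k}. M)"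
    if "i \<in> {1..k}" "j \<in> {1..k}" for i j c d
    by (rule measurable_compose[OF _ poi_measurable]) (use comp that in measurable)
  show ?thesis
    unfolding poisson_integrand_def[abs_def]
    by (intro borel_measurable_prod measurable_If borel_measurable_times poi') auto
qed

lemma poisson_integrand_bounded:
  assumes "\<rho> > 0"
  shows "\<bar>poisson_integrand k A \<rho> x\<bar> \<le> 1"
  unfolding poisson_integrand_def
proof (intro abs_prod_le_1)
  fix i j
  have "\<bar>poi c (\<bar>x i\<bar> * \<bar>x j\<bar> / d)\<bar> \<le> 1" if "d > 0" for c d
    using that by (simp add: abs_of_nonneg poi_nonneg poi_le_1)
  then show "\<bar>if i \<noteq> j then poi (A i j) (\<bar>x i\<bar> * \<bar>x j\<bar> / \<rho>)
        else of_bool (even (A i j)) * poi (A i j div 2) (\<bar>x i\<bar> * \<bar>x j\<bar> / (2 * \<rho>))\<bar> \<le> 1"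
    using assms by auto
qed

lemma poisson_integrand_tendsto:
  assumes "\<And>i. i \<in> {1..k} \<Longrightarrow> (\<lambda>n. x n i) \<longlonglongrightarrow> y i" "\<rho> > 0"
  shows "(\<lambda>n. poisson_integrand k A \<rho> (x n)) \<longlonglongrightarrow> poisson_integrand k A \<rho> y"
  unfolding poisson_integrand_def
proof (intro tendsto_prod)
  fix i j assume "i \<in> {1..k}" "j \<in> {i..k}"
  then have "(\<lambda>n. x n i) \<longlonglongrightarrow> y i" "(\<lambda>n. x n j) \<longlonglongrightarrow> y j"
    using assms by auto
  then show "(\<lambda>n. if i \<noteq> j then poi (A i j) (\<bar>x n i\<bar> * \<bar>x n j\<bar> / \<rho>)
        else of_bool (even (A i j)) * poi (A i j div 2) (\<bar>x n i\<bar> * \<bar>x n j\<bar> / (2 * \<rho>))) \<longlonglongrightarrow>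
      (if i \<noteq> j then poi (A i j) (\<bar>y i\<bar> * \<bar>y j\<bar> / \<rho>)
        else of_bool (even (A i j)) * poi (A i j div 2) (\<bar>y i\<bar> * \<bar>y j\<bar> / (2 * \<rho>)))"
    using assms(2) by (cases "i = j") (auto intro!: tendsto_intros)
qed

lemma poisson_integrand_cong:
  assumes "\<And>i. i \<in> {1..k} \<Longrightarrow> x i = y i"
  shows "poisson_integrand k A \<rho> x = poisson_integrand k A \<rho> y"
  unfolding poisson_integrand_def using assms by (intro prod.cong refl) auto

text \<open>Independent samples from the image law are images of independent samples from
  \<open>P\<close>: the product of the image measures is the image of the product measure.\<close>

lemma poisson_density_distr:
  assumes P: "prob_space P" and g [measurable]: "g \<in> borel_measurable P"
  shows "poisson_density k A \<rho> (distr P borel g) =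
         (\<integral>x. poisson_integrand k A \<rho> (\<lambda>i. g (x i)) \<partial>(\<Pi>\<^sub>M i\<in>{1..k}. P))"
proof -
  let ?D = "distr P borel g"
  interpret prob_space P by (rule P)
  have D: "prob_space ?D" by (rule prob_space_distr) simp
  have gD: "g \<in> P \<rightarrow>\<^sub>M ?D" by simp
  have "(\<Pi>\<^sub>M i\<in>{1..k}. ?D) = (\<Pi>\<^sub>M i\<in>{1..k}. distr P ?D g)"
    by (intro PiM_cong refl distr_cong) auto
  also have "\<dots> = distr (\<Pi>\<^sub>M i\<in>{1..k}. P) (\<Pi>\<^sub>M i\<in>{1..k}. ?D) (compose {1..k} g)"
    using P D gD by (intro distr_PiM_finite_prob_space'[symmetric]) auto
  finally have eq: "(\<Pi>\<^sub>M i\<in>{1..k}. ?D) =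
      distr (\<Pi>\<^sub>M i\<in>{1..k}. P) (\<Pi>\<^sub>M i\<in>{1..k}. ?D) (compose {1..k} g)" .
  have comp: "compose {1..k} g \<in> (\<Pi>\<^sub>M i\<in>{1..k}. P) \<rightarrow>\<^sub>M (\<Pi>\<^sub>M i\<in>{1..k}. ?D)"
    unfolding compose_def by (intro measurable_restrict) (use gD in measurable)
  have "poisson_density k A \<rho> ?D =
      (\<integral>x. poisson_integrand k A \<rho> (compose {1..k} g x) \<partial>(\<Pi>\<^sub>M i\<in>{1..k}. P))"
    unfolding poisson_density_def
    by (subst eq, rule integral_distr[OF comp]) (rule poisson_integrand_measurable, simp)
  also have "\<dots> = (\<integral>x. poisson_integrand k A \<rho> (\<lambda>i. g (x i)) \<partial>(\<Pi>\<^sub>M i\<in>{1..k}. P))"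
    by (intro Bochner_Integration.integral_cong refl poisson_integrand_cong) (simp add: compose_def)
  finally show ?thesis .
qed

text \<open>With all coordinates except \<open>j\<close> fixed, equality with coordinate
  \<open>i\<close> leaves at most a single point, hence a null set; Tonelli integrates this over the
  other coordinates.\<close>

lemma AE_cube_distinct:
  assumes ij: "i \<in> {1..k}" "j \<in> {1..k}" "i \<noteq> j"
  shows "AE x in cube_measure k. x i \<noteq> x j"
proof -
  define I where "I = {1..k} - {j}"
  have ins: "{1..k} = insert j I" "finite I" "j \<notin> I" "i \<in> I"
    using ij by (auto simp: I_def)
  have meas [measurable]: "(\<lambda>x. x l) \<in> borel_measurable (cube_measure k)" if "l \<in> {1..k}" for l
    using that measurable_compose[OF measurable_component_singleton[OF that] id_measurable_unit] by simp
  have set [measurable]: "{x \<in> space (cube_measure k). x i = x j} \<in> sets (cube_measure k)"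
    using ij by measurable
  have "emeasure (cube_measure k) {x \<in> space (cube_measure k). x i = x j} =
      (\<integral>\<^sup>+x. indicator {x \<in> space (cube_measure k). x i = x j} x \<partial>cube_measure k)"
    by (rule nn_integral_indicator[symmetric, OF set])
  also have "\<dots> = (\<integral>\<^sup>+x. \<integral>\<^sup>+y. indicator {x \<in> space (cube_measure k). x i = x j} (x(j := y))
      \<partial>unit_lebesgue \<partial>(\<Pi>\<^sub>M i\<in>I. unit_lebesgue))"
    using set unfolding ins(1) by (intro cube.product_nn_integral_insert ins) simp
  also have "\<dots> \<le> (\<integral>\<^sup>+x. \<integral>\<^sup>+y. indicator {x i} y \<partial>unit_lebesgue \<partial>(\<Pi>\<^sub>M i\<in>I. unit_lebesgue))"
    using ij by (intro nn_integral_mono) (auto split: split_indicator)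
  also have "\<dots> = 0"
  proof -
    have "(\<integral>\<^sup>+y. indicator {c} y \<partial>unit_lebesgue) = 0" for c :: real
    proof -
      have "(\<integral>\<^sup>+y. indicator {c} y \<partial>unit_lebesgue) = (\<integral>\<^sup>+y. 0 \<partial>unit_lebesgue)"
        by (intro nn_integral_cong_AE) (use AE_unit_lebesgue_neq[of c] in eventually_elim, simp)
      then show ?thesis by simp
    qed
    then show ?thesis by simp
  qed
  finally have "emeasure (cube_measure k) {x \<in> space (cube_measure k). x i = x j} = 0"
    by simp
  then show ?thesis
    using set by (subst AE_iff_measurable[of "{x \<in> space (cube_measure k). x i = x j}"]) auto
qed

text \<open>\<open>poisson_mg\<close> separates cases by equality of points,
  \<open>poisson_integrand\<close> by equality of indices. The two agree where coordinates with
  distinct indices differ and all weights are nonnegative, that is, almost everywhere.\<close>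

lemma t_eq_poisson_mg:
  assumes g: "g \<in> borel_measurable unit_lebesgue" and "AE u in unit_lebesgue. 0 \<le> g u"
  shows "t_eq k A (poisson_mg \<rho> g) = poisson_density k A \<rho> (distr unit_lebesgue borel g)"
proof -
  have distinct: "AE x in cube_measure k. \<forall>i\<in>{1..k}. \<forall>j\<in>{1..k}. i \<noteq> j \<longrightarrow> x i \<noteq> x j"
    by (intro AE_ball_countable' countable_finite AE_impI) (auto intro: AE_cube_distinct)
  have nonneg: "AE x in cube_measure k. \<forall>i\<in>{1..k}. 0 \<le> g (x i)"
    by (intro AE_ball_countable' countable_finite AE_PiM_component[where P="\<lambda>u. 0 \<le> g u"]
        prob_space_unit_lebesgue assms) auto
  have gm: "(\<lambda>x. g (x i)) \<in> borel_measurable (cube_measure k)" if "i \<in> {1..k}" for i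
    using measurable_compose[OF measurable_component_singleton[OF that] g] by simp
  \<comment> \<open>Points of the product space are \<open>undefined\<close> outside
    \<open>{1..k}\<close>, so measurability is shown for the restricted function; the integrand
    reads only these indices.\<close>
  have "(\<lambda>x. poisson_integrand k A \<rho> (\<lambda>i\<in>{1..k}. g (x i))) \<in> borel_measurable (cube_measure k)"
    by (rule measurable_compose[OF _ poisson_integrand_measurable[of borel, OF refl]])
       (intro measurable_restrict gm)
  then have meas: "(\<lambda>x. poisson_integrand k A \<rho> (\<lambda>i. g (x i))) \<in> borel_measurable (cube_measure k)"
    by (rule measurable_cong[THEN iffD1, rotated]) (intro poisson_integrand_cong, simp)
  show ?thesis
    unfolding poisson_density_distr[OF prob_space_unit_lebesgue g] t_eq_unit_lebesgue
  proof (rule integral_cong_AE)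
    show "AE x in cube_measure k.
        (\<Prod>i\<in>{1..k}. \<Prod>j\<in>{i..k}. poisson_mg \<rho> g (x i) (x j) (A i j)) =
        poisson_integrand k A \<rho> (\<lambda>i. g (x i))"
      using distinct nonneg
    proof eventually_elim
      case (elim x)
      show ?case
        unfolding poisson_integrand_def
      proof (intro prod.cong refl)
        fix i j assume ij: "i \<in> {1..k}" "j \<in> {i..k}"
        then have "x i \<noteq> x j" if "i \<noteq> j"
          using elim(1) that by auto
        moreover have "0 \<le> g (x i)" "0 \<le> g (x j)"
          using elim(2) ij by auto
        ultimately show "poisson_mg \<rho> g (x i) (x j) (A i j) =
            (if i \<noteq> j then poi (A i j) (\<bar>g (x i)\<bar> * \<bar>g (x j)\<bar> / \<rho>)
             else of_bool (even (A i j)) * poi (A i j div 2) (\<bar>g (x i)\<bar> * \<bar>g (x j)\<bar> / (2 * \<rho>)))"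
          by (cases "i = j") (simp_all add: poisson_mg_def)
      qed
    qed
  qed (rule integrand_measurable[OF poisson_mg_measurable[OF g]], rule meas)
qed

text \<open>By Skorohod's theorem the samples can be coupled so that they converge pointwise.\<close>

lemma poisson_density_weak_conv:
  assumes M: "\<And>n. real_distribution (M n)" "real_distribution M'" "weak_conv_m M M'" and "\<rho> > 0"
  shows "(\<lambda>n. poisson_density k A \<rho> (M n)) \<longlonglongrightarrow> poisson_density k A \<rho> M'"
proof -
  obtain \<Omega> :: "real measure" and X Y where
    "prob_space \<Omega> \<and> (\<forall>n. X n \<in> borel_measurable \<Omega>) \<and> (\<forall>n. distr \<Omega> borel (X n) = M n) \<and>
     Y \<in> \<Omega> \<rightarrow>\<^sub>M lborel \<and> distr \<Omega> borel Y = M' \<and> (\<forall>x\<in>space \<Omega>. (\<lambda>n. X n x) \<longlonglongrightarrow> Y x)"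
    using Skorohod[OF M] by (elim exE)
  then have \<Omega>: "prob_space \<Omega>"
    and X: "\<And>n. X n \<in> borel_measurable \<Omega>" "\<And>n. distr \<Omega> borel (X n) = M n"
    and Y: "Y \<in> borel_measurable \<Omega>" "distr \<Omega> borel Y = M'"
    and lim: "\<And>x. x \<in> space \<Omega> \<Longrightarrow> (\<lambda>n. X n x) \<longlonglongrightarrow> Y x"
    by simp_all
  have meas: "(\<lambda>x. poisson_integrand k A \<rho> (\<lambda>i. Z (x i))) \<in> borel_measurable (\<Pi>\<^sub>M i\<in>{1..k}. \<Omega>)"
    if Z: "Z \<in> borel_measurable \<Omega>" for Z
  proof -
    have "(\<lambda>x. poisson_integrand k A \<rho> (\<lambda>i\<in>{1..k}. Z (x i))) \<in> borel_measurable (\<Pi>\<^sub>M i\<in>{1..k}. \<Omega>)"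
      by (rule measurable_compose[OF _ poisson_integrand_measurable[of borel, OF refl]])
         (intro measurable_restrict measurable_compose[OF measurable_component_singleton[where M="\<lambda>_. \<Omega>"] Z])
    then show ?thesis
      by (rule measurable_cong[THEN iffD1, rotated]) (intro poisson_integrand_cong, simp)
  qed
  interpret P: prob_space "\<Pi>\<^sub>M i\<in>{1..k}. \<Omega>"
    by (intro prob_space_PiM \<Omega>)
  have "(\<lambda>n. \<integral>x. poisson_integrand k A \<rho> (\<lambda>i. X n (x i)) \<partial>(\<Pi>\<^sub>M i\<in>{1..k}. \<Omega>)) \<longlonglongrightarrow>
      (\<integral>x. poisson_integrand k A \<rho> (\<lambda>i. Y (x i)) \<partial>(\<Pi>\<^sub>M i\<in>{1..k}. \<Omega>))"
  proof (rule integral_dominated_convergence[where w="\<lambda>_. 1"])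
    show "AE x in \<Pi>\<^sub>M i\<in>{1..k}. \<Omega>. (\<lambda>n. poisson_integrand k A \<rho> (\<lambda>i. X n (x i))) \<longlonglongrightarrow>
        poisson_integrand k A \<rho> (\<lambda>i. Y (x i))"
      using \<open>\<rho> > 0\<close>
      by (intro AE_I2 poisson_integrand_tendsto lim) (auto simp: space_PiM PiE_iff)
    show "AE x in \<Pi>\<^sub>M i\<in>{1..k}. \<Omega>. norm (poisson_integrand k A \<rho> (\<lambda>i. X n (x i))) \<le> 1" for n
      using poisson_integrand_bounded[OF \<open>\<rho> > 0\<close>] by simp
  qed (intro meas X Y, intro meas X Y, rule P.integrable_const)
  then show ?thesis
    using poisson_density_distr[OF \<Omega> X(1), unfolded X(2)] poisson_density_distr[OF \<Omega> Y(1), unfolded Y(2)]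
    by simp
qed

section \<open>Quantile functions and inverse transform sampling\<close>

lemma (in cdf_distribution) quantile_eq_pseudoinverse:
  assumes "\<And>x. x < 0 \<Longrightarrow> C x = 0" "0 < u" "u < 1"
  shows "quantile C u = I u"
  unfolding quantile_def
\<comment> \<open>\<open>I u\<close> is the least \<open>z\<close> with \<open>u \<le> C z\<close>,
  without a sign condition. As \<open>C\<close> vanishes on the negative half-line and
  \<open>u > 0\<close>, such \<open>z\<close> are nonnegative, so both minima agree.\<close>
proof (rule Least_equality)
  have "u \<le> C (I u)"
    using pseudoinverse assms by blast
  moreover from this have "0 \<le> I u"
    using assms(1)[of "I u"] \<open>0 < u\<close> by linarith
  ultimately show "0 \<le> I u \<and> u \<le> C (I u)" by simp
  show "I u \<le> y" if "0 \<le> y \<and> u \<le> C y" for y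
    using pseudoinverse[of u y] assms that by blast
qed

text \<open>Inverse transform sampling. On \<open>{0<..<1}\<close> the quantile function is the
  pseudoinverse \<open>I\<close>, whose law is \<open>M\<close>; the endpoints form a null set, so
  an unspecified value there does no harm.\<close>

lemma (in cdf_distribution) quantile_distr:
  assumes nonneg: "\<And>x. x < 0 \<Longrightarrow> C x = 0"
  shows "quantile C \<in> borel_measurable unit_lebesgue"
    and "AE u in unit_lebesgue. 0 \<le> quantile C u"
    and "distr unit_lebesgue borel (quantile C) = M"
proof -
  have AE_01: "AE u in unit_lebesgue. u \<in> {0<..<1}"
    using AE_unit_lebesgue_neq[of 0] AE_unit_lebesgue_neq[of 1] AE_space[of unit_lebesgue]
    by eventually_elim auto
  have "(\<lambda>u. if u \<in> {0<..<1} then I u else 0) \<in> borel_measurable borel"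
    by (subst measurable_If_restrict_space_iff) (simp_all only: Collect_mem_eq measurable_CI, auto)
  then have "(\<lambda>u. if u \<in> {0<..<1} then I u else 0) \<in> borel_measurable unit_lebesgue"
    by (rule borel_imp_measurable_unit)
  then show meas: "quantile C \<in> borel_measurable unit_lebesgue"
  proof (rule measurable_discrete_difference[where X="{0, 1}"])
    show "{x} \<in> sets unit_lebesgue" if "x \<in> {0, 1}" for x :: real
      using that by (auto simp: sets_unit_lebesgue sets_restrict_space_iff)
    show "(if u \<in> {0<..<1} then I u else 0) = quantile C u"
      if "u \<in> space unit_lebesgue" "u \<notin> {0, 1}" for u
      using that quantile_eq_pseudoinverse[OF nonneg, of u] by auto
  qed auto
  show "AE u in unit_lebesgue. 0 \<le> quantile C u"
    using AE_01
  proof eventually_elim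
    case (elim u)
    then have "u \<le> C (I u)"
      using pseudoinverse[of u "I u"] by simp
    then have "0 \<le> I u"
      using nonneg[of "I u"] elim by force
    then show ?case
      using elim quantile_eq_pseudoinverse[OF nonneg, of u] by simp
  qed
  have "distr unit_lebesgue borel (quantile C) = distr (restrict_space lborel {0<..<1}) borel I"
  proof (rule measure_eqI)
    fix S assume "S \<in> sets (distr unit_lebesgue borel (quantile C))"
    then have S [measurable]: "S \<in> sets borel" by simp
    have s1: "quantile C -` S \<inter> {0..1} \<in> sets borel"
      using measurable_sets[OF meas S] by (simp add: sets_unit_lebesgue sets_restrict_space_iff)
    have s2: "I -` S \<inter> {0<..<1} \<in> sets borel"
      using measurable_sets[OF measurable_CI S] by (simp add: space_restrict_space sets_restrict_space_iff)
    have "emeasure (distr unit_lebesgue borel (quantile C)) S = emeasure lborel (quantile C -` S \<inter> {0..1})"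
      using meas by (subst emeasure_distr) (auto simp: unit_lebesgue_def emeasure_restrict_space space_restrict_space)
    also have "\<dots> = emeasure lborel (I -` S \<inter> {0<..<1})"
    proof (rule emeasure_eq_AE)
      show "AE x in lborel. (x \<in> quantile C -` S \<inter> {0..1}) = (x \<in> I -` S \<inter> {0<..<1})"
        using AE_lborel_singleton[of 0] AE_lborel_singleton[of 1]
        by eventually_elim (auto simp: quantile_eq_pseudoinverse[OF nonneg])
    qed (use s1 s2 in auto)
    also have "\<dots> = emeasure (distr (restrict_space lborel {0<..<1}) borel I) S"
      by (subst emeasure_distr)
         (auto simp: emeasure_restrict_space space_restrict_space measurable_cong_sets[OF sets_restrict_space_cong[OF sets_lborel] refl])
    finally show "emeasure (distr unit_lebesgue borel (quantile C)) S =
        emeasure (distr (restrict_space lborel {0<..<1}) borel I) S" .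
  qed simp
  then show "distr unit_lebesgue borel (quantile C) = M"
    by (simp add: distr_I_eq_M)
qed

lemma t_eq_mg_of_distr:
  assumes "real_distribution M" "\<And>x. x < 0 \<Longrightarrow> cdf M x = 0"
  shows "t_eq k A (mg_of_distr \<rho> (cdf M)) = poisson_density k A \<rho> M"
proof -
  interpret cdf_distribution M
    unfolding cdf_distribution_def by (rule assms(1))
  show ?thesis
    unfolding mg_of_distr_eq_poisson_mg
    by (subst t_eq_poisson_mg) (use quantile_distr[OF assms(2)] in auto)
qed

section \<open>Gamma distributions and their Poisson mixtures\<close>

lemma gamma_dens_measurable [measurable]: "(\<lambda>x. gamma_dens x a b) \<in> borel_measurable borel"
  unfolding gamma_dens_def by measurable

lemma gamma_dens_nonneg: "0 < a \<Longrightarrow> 0 < b \<Longrightarrow> 0 \<le> gamma_dens x a b"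
  by (auto simp: gamma_dens_def intro!: mult_nonneg_nonneg divide_nonneg_pos)

lemma gamma_dens_nonpos: "x \<le> 0 \<Longrightarrow> gamma_dens x a b = 0"
  by (simp add: gamma_dens_def)

text \<open>Scaling by \<open>b\<close> turns the total mass into Euler's integral for
  \<open>Gamma a\<close>, whose integrand is \<open>f\<close>.\<close>

lemma nn_integral_gamma_dens:
  assumes ab: "0 < a" "0 < b"
  shows "(\<integral>\<^sup>+x. ennreal (gamma_dens x a b) \<partial>lborel) = 1"
proof -
  define f :: "real \<Rightarrow> real" where "f t = indicator {0..} t * t powr (a - 1) / exp t" for t
  have G: "Gamma a > 0" using ab by (simp add: Gamma_real_pos)
  have eq: "gamma_dens x a b = b / Gamma a * f (b * x)" if "x \<noteq> 0" for x
  proof (cases "x > 0")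
    case True
    have "b powr a = b * b powr (a - 1)"
      using ab by (simp add: powr_diff)
    then show ?thesis
      using True ab by (simp add: gamma_dens_def f_def powr_mult exp_minus field_simps)
  next
    case False
    then have "b * x < 0"
      using that ab by (simp add: mult_pos_neg)
    then show ?thesis
      using False by (simp add: gamma_dens_def f_def)
  qed
  have "(\<integral>\<^sup>+x. ennreal (gamma_dens x a b) \<partial>lborel) = (\<integral>\<^sup>+x. ennreal (1 / Gamma a) * (ennreal b * ennreal (f (b * x))) \<partial>lborel)"
  proof (rule nn_integral_cong_AE)
    show "AE x in lborel. ennreal (gamma_dens x a b) = ennreal (1 / Gamma a) * (ennreal b * ennreal (f (b * x)))"
      using AE_lborel_singleton[of 0]
    proof eventually_elim
      case (elim x)
      have "0 \<le> f (b * x)" by (simp add: f_def)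
      then show ?case
        using elim ab G by (simp add: eq ennreal_mult[symmetric])
    qed
  qed
  also have "\<dots> = ennreal (1 / Gamma a) * (ennreal b * (\<integral>\<^sup>+x. ennreal (f (b * x)) \<partial>lborel))"
    unfolding f_def by (simp add: nn_integral_cmult)
  also have "ennreal b * (\<integral>\<^sup>+x. ennreal (f (b * x)) \<partial>lborel) = (\<integral>\<^sup>+x. ennreal (f x) \<partial>lborel)"
    using ab nn_integral_real_affine[of "\<lambda>x. ennreal (f x)" b 0] by (simp add: f_def)
  also have "\<dots> = ennreal (Gamma a)"
    using Gamma_conv_nn_integral_real[OF ab(1)] by (simp add: f_def)
  also have "ennreal (1 / Gamma a) * ennreal (Gamma a) = 1"
    using G by (simp add: ennreal_mult[symmetric])
  finally show ?thesis .
qed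

lemma has_bochner_integral_gamma_dens:
  assumes "0 < a" "0 < b"
  shows "has_bochner_integral lborel (\<lambda>x. gamma_dens x a b) 1"
  using gamma_dens_nonneg[OF assms] nn_integral_gamma_dens[OF assms]
  by (intro has_bochner_integral_nn_integral) auto

text \<open>By \<open>Gamma (a + 1) = a * Gamma a\<close> a factor \<open>x\<close> raises the shape
  by one. Moments thus reduce to total masses.\<close>

lemma gamma_dens_Suc:
  assumes "0 < a" "0 < b"
  shows "x * gamma_dens x a b = a / b * gamma_dens x (a + 1) b"
proof (cases "x > 0")
  case True
  have "Gamma (a + 1) = a * Gamma a"
    using assms by (intro Gamma_plus1) (auto elim!: nonpos_Ints_cases)
  moreover have "x powr a = x * x powr (a - 1)" "b powr (a + 1) = b * b powr a"
    using assms True by (simp_all add: powr_diff powr_add)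
  moreover have "Gamma a > 0"
    using assms by (simp add: Gamma_real_pos)
  ultimately show ?thesis
    using True assms by (simp add: gamma_dens_def field_simps)
qed (simp add: gamma_dens_def)

text \<open>Two shape shifts give the mean \<open>a / b\<close> and the second moment
  \<open>a * (a + 1) / b^2\<close>.\<close>

lemma nn_integral_gamma_dens_square:
  assumes ab: "0 < a" "0 < b"
  shows "(\<integral>\<^sup>+y. ennreal ((y - z)\<^sup>2 * gamma_dens y a b) \<partial>lborel) =
         ennreal (a * (a + 1) / b\<^sup>2 - 2 * z * a / b + z\<^sup>2)"
proof -
  have y1: "y * gamma_dens y a b = a / b * gamma_dens y (a + 1) b" for y
    by (rule gamma_dens_Suc[OF ab])
  have y2: "y * gamma_dens y (a + 1) b = (a + 1) / b * gamma_dens y (a + 1 + 1) b" for y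
    by (rule gamma_dens_Suc) (use ab in auto)
  have "(y - z)\<^sup>2 * gamma_dens y a b = y * (y * gamma_dens y a b) - 2 * z * (y * gamma_dens y a b)
      + z\<^sup>2 * gamma_dens y a b" for y
    by (simp add: power2_eq_square algebra_simps)
  also have "\<dots> y = a / b * (y * gamma_dens y (a + 1) b) - 2 * z * (y * gamma_dens y a b)
      + z\<^sup>2 * gamma_dens y a b" for y
    unfolding y1 by simp
  finally have eq: "(y - z)\<^sup>2 * gamma_dens y a b = a / b * ((a + 1) / b * gamma_dens y (a + 1 + 1) b)
      - 2 * z * (a / b * gamma_dens y (a + 1) b) + z\<^sup>2 * gamma_dens y a b" for y
    unfolding y1 y2 .
  have "has_bochner_integral lborel (\<lambda>y. (y - z)\<^sup>2 * gamma_dens y a b)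
      (a / b * ((a + 1) / b * 1) - 2 * z * (a / b * 1) + z\<^sup>2 * 1)"
    unfolding eq using ab
    by (intro has_bochner_integral_add has_bochner_integral_diff has_bochner_integral_mult_right
        has_bochner_integral_gamma_dens) auto
  then have "has_bochner_integral lborel (\<lambda>y. (y - z)\<^sup>2 * gamma_dens y a b)
      (a * (a + 1) / b\<^sup>2 - 2 * z * a / b + z\<^sup>2)"
    by (simp add: power2_eq_square)
  then show ?thesis
    using gamma_dens_nonneg[OF ab] by (simp add: has_bochner_integral_iff nn_integral_eq_integral)
qed

text \<open>A crude geometric lower bound, enough to compare the gamma mixture with an exponential
  series.\<close>

lemma Gamma_ge_power:
  assumes "0 < (a :: real)"
  shows "a ^ i * Gamma a \<le> Gamma (a + real i)"
proof (induction i)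
  case (Suc i)
  have "a + real i \<notin> \<int>\<^sub>\<le>\<^sub>0"
    using assms nonpos_Ints_nonpos[of "a + real i"] by force
  from Gamma_plus1[OF this] have "Gamma (a + real (Suc i)) = (a + real i) * Gamma (a + real i)"
    by (simp add: add_ac)
  moreover have "a * (a ^ i * Gamma a) \<le> (a + real i) * Gamma (a + real i)"
    using assms by (intro mult_mono Suc) (auto intro!: mult_nonneg_nonneg less_imp_le Gamma_real_pos)
  ultimately show ?case by simp
qed simp

text \<open>With \<open>c = \<tau>(\<alpha>, t)\<close> and \<open>b = c + \<alpha>\<close> this is the kernel \<open>f(t, z, y)\<close>.\<close>

definition gamma_mixture :: "real \<Rightarrow> real \<Rightarrow> real \<Rightarrow> real \<Rightarrow> real \<Rightarrow> real" where
  "gamma_mixture \<kappa> c b z y = (\<Sum>i. poi i (z * c) * gamma_dens y (\<kappa> + real i) b)"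

lemma fker_eq_gamma_mixture:
  "fker \<kappa> \<rho> t z y = gamma_mixture \<kappa> (tau (\<kappa> / \<rho>) t) (tau (\<kappa> / \<rho>) t + \<kappa> / \<rho>) z y"
  by (simp add: fker_def gamma_mixture_def Let_def)

context
  fixes \<kappa> c b :: real
  assumes pos: "0 < \<kappa>" "0 < c" "0 < b"
begin

lemma gamma_mixture_term_nonneg:
  "0 \<le> z \<Longrightarrow> 0 \<le> poi i (z * c) * gamma_dens y (\<kappa> + real i) b"
  using pos by (intro mult_nonneg_nonneg poi_nonneg gamma_dens_nonneg) auto

text \<open>By \<open>Gamma_ge_power\<close>, passing to shape \<open>\<kappa> + real i\<close>
  costs at most the factor \<open>(y * b / \<kappa>) ^ i\<close>. The Poisson weight supplies
  \<open>1 / fact i\<close>, so the exponential series in \<open>w\<close> is a majorant.\<close>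

lemma gamma_mixture_summable:
  assumes "0 \<le> z"
  shows "summable (\<lambda>i. poi i (z * c) * gamma_dens y (\<kappa> + real i) b)"
proof (cases "y > 0")
  case True
  define g where "g = gamma_dens y \<kappa> b * exp (- (z * c))"
  define w where "w = z * c * (y * b / \<kappa>)"
  show ?thesis
  proof (rule summable_comparison_test')
    show "summable (\<lambda>i. g * (w ^ i /\<^sub>R fact i))"
      by (intro summable_mult summable_exp_generic)
    fix i
    have G: "0 < Gamma \<kappa>"
      using pos by (simp add: Gamma_real_pos)
    have "gamma_dens y (\<kappa> + real i) b =
        y powr (\<kappa> - 1) * b powr \<kappa> * exp (- b * y) * (y * b) ^ i / Gamma (\<kappa> + real i)"
      using True pos
      by (simp add: gamma_dens_def powr_add powr_diff powr_realpow power_mult_distrib field_simps)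
    also have "\<dots> \<le> y powr (\<kappa> - 1) * b powr \<kappa> * exp (- b * y) * (y * b) ^ i / (\<kappa> ^ i * Gamma \<kappa>)"
      using True pos G Gamma_ge_power[OF pos(1)]
      by (intro divide_left_mono mult_nonneg_nonneg mult_pos_pos) (auto intro!: Gamma_real_pos)
    also have "\<dots> = gamma_dens y \<kappa> b * (y * b / \<kappa>) ^ i"
      using True by (simp add: gamma_dens_def power_divide field_simps)
    finally have "poi i (z * c) * gamma_dens y (\<kappa> + real i) b \<le>
        poi i (z * c) * (gamma_dens y \<kappa> b * (y * b / \<kappa>) ^ i)"
      using assms pos by (intro mult_left_mono poi_nonneg) auto
    also have "\<dots> = g * (w ^ i /\<^sub>R fact i)"
      by (simp add: poi_def g_def w_def power_mult_distrib power_divide field_simps)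
    finally show "norm (poi i (z * c) * gamma_dens y (\<kappa> + real i) b) \<le> g * (w ^ i /\<^sub>R fact i)"
      using gamma_mixture_term_nonneg[OF assms] by (simp add: abs_of_nonneg)
  qed
qed (simp add: gamma_dens_nonpos)

lemma gamma_mixture_nonneg: "0 \<le> z \<Longrightarrow> 0 \<le> gamma_mixture \<kappa> c b z y"
  unfolding gamma_mixture_def
  by (intro suminf_nonneg gamma_mixture_summable gamma_mixture_term_nonneg)

lemma gamma_mixture_nonpos: "y \<le> 0 \<Longrightarrow> gamma_mixture \<kappa> c b z y = 0"
  by (simp add: gamma_mixture_def gamma_dens_nonpos)

lemma gamma_mixture_measurable [measurable]:
  "(\<lambda>(z, y). gamma_mixture \<kappa> c b z y) \<in> borel_measurable (borel \<Otimes>\<^sub>M borel)"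
  unfolding gamma_mixture_def by measurable

lemma gamma_mixture_measurable_snd [measurable]: "gamma_mixture \<kappa> c b z \<in> borel_measurable borel"
  unfolding gamma_mixture_def[abs_def] by measurable

text \<open>Monotone convergence, term by term in the Poisson number. The factor \<open>h\<close> is
  the constant 1 for the total mass and the squared distance to \<open>z\<close> for the mean square
  distance.\<close>

lemma nn_integral_gamma_mixture:
  assumes z: "0 \<le> z" and h: "h \<in> borel_measurable borel" "\<And>y. 0 \<le> h y"
  shows "(\<integral>\<^sup>+y. ennreal (h y * gamma_mixture \<kappa> c b z y) \<partial>lborel) =
    (\<Sum>i. ennreal (poi i (z * c)) * (\<integral>\<^sup>+y. ennreal (h y * gamma_dens y (\<kappa> + real i) b) \<partial>lborel))"
proof -
  note h(1)[measurable]
  have "ennreal (h y * gamma_mixture \<kappa> c b z y) =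
      (\<Sum>i. ennreal (poi i (z * c)) * ennreal (h y * gamma_dens y (\<kappa> + real i) b))" for y
  proof -
    have "ennreal (h y * gamma_mixture \<kappa> c b z y) =
        ennreal (\<Sum>i. h y * (poi i (z * c) * gamma_dens y (\<kappa> + real i) b))"
      unfolding gamma_mixture_def by (simp add: suminf_mult gamma_mixture_summable[OF z])
    also have "\<dots> = (\<Sum>i. ennreal (h y * (poi i (z * c) * gamma_dens y (\<kappa> + real i) b)))"
      by (intro suminf_ennreal2[symmetric] summable_mult gamma_mixture_summable z
          mult_nonneg_nonneg[OF h(2)] gamma_mixture_term_nonneg)
    also have "\<dots> = (\<Sum>i. ennreal (poi i (z * c)) * ennreal (h y * gamma_dens y (\<kappa> + real i) b))"
    proof (intro suminf_cong)
      fix i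
      have "0 \<le> poi i (z * c)" "0 \<le> gamma_dens y (\<kappa> + real i) b"
        using pos z by (auto intro!: poi_nonneg gamma_dens_nonneg)
      then show "ennreal (h y * (poi i (z * c) * gamma_dens y (\<kappa> + real i) b)) =
          ennreal (poi i (z * c)) * ennreal (h y * gamma_dens y (\<kappa> + real i) b)"
        using h(2) by (subst ennreal_mult[symmetric]) (auto simp: mult_ac)
    qed
    finally show ?thesis .
  qed
  then show ?thesis
    by (simp add: nn_integral_suminf nn_integral_cmult)
qed

lemma nn_integral_gamma_mixture_1:
  assumes "0 \<le> z"
  shows "(\<integral>\<^sup>+y. ennreal (gamma_mixture \<kappa> c b z y) \<partial>lborel) = 1"
proof -
  have "(\<integral>\<^sup>+y. ennreal (gamma_mixture \<kappa> c b z y) \<partial>lborel) = (\<Sum>i. ennreal (poi i (z * c)))"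
    using nn_integral_gamma_mixture[OF assms, of "\<lambda>_. 1"] pos by (simp add: nn_integral_gamma_dens)
  also have "\<dots> = ennreal 1"
    using assms pos by (intro suminf_ennreal_eq poi_nonneg poi_sums) auto
  finally show ?thesis by simp
qed

lemma has_bochner_integral_gamma_mixture:
  assumes "0 \<le> z"
  shows "has_bochner_integral lborel (gamma_mixture \<kappa> c b z) 1"
  using gamma_mixture_nonneg[OF assms] nn_integral_gamma_mixture_1[OF assms]
  by (intro has_bochner_integral_nn_integral) auto

end

section \<open>Moments of the Poisson distribution and of the gamma mixture\<close>

lemma poi_Suc: "real (Suc k) * poi (Suc k) l = l * poi k l"
  by (simp add: poi_def fact_Suc del: of_nat_Suc)

text \<open>\<open>poi_Suc\<close> shifts the index by one, and the term at 0 vanishes, so the mean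
  reduces to the total mass. The second moment reduces in the same way to mean and mass.\<close>

lemma poi_mean_sums: "(\<lambda>k. real k * poi k l) sums l"
proof -
  have "(\<lambda>k. l * poi k l) sums (l * 1)"
    by (intro sums_mult poi_sums)
  then have "(\<lambda>k. real (Suc k) * poi (Suc k) l) sums l"
    by (simp only: poi_Suc mult_1_right)
  then show ?thesis
    by (subst (asm) sums_Suc_iff) simp
qed

lemma poi_square_sums: "(\<lambda>k. (real k)\<^sup>2 * poi k l) sums (l\<^sup>2 + l)"
proof -
  have "(\<lambda>k. l * (real k * poi k l) + l * poi k l) sums (l * l + l * 1)"
    by (intro sums_add sums_mult poi_sums poi_mean_sums)
  also have "(\<lambda>k. l * (real k * poi k l) + l * poi k l) = (\<lambda>k. (real (Suc k))\<^sup>2 * poi (Suc k) l)"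
  proof
    fix k
    have "(real (Suc k))\<^sup>2 * poi (Suc k) l = real (Suc k) * (real (Suc k) * poi (Suc k) l)"
      by (simp add: power2_eq_square)
    also have "\<dots> = real (Suc k) * (l * poi k l)"
      by (simp only: poi_Suc)
    finally show "l * (real k * poi k l) + l * poi k l = (real (Suc k))\<^sup>2 * poi (Suc k) l"
      by (simp add: algebra_simps)
  qed
  finally show ?thesis
    by (subst (asm) sums_Suc_iff) (simp add: power2_eq_square)
qed

text \<open>Mean square distance from \<open>z\<close> under the mixture density started at
  \<open>z\<close>, in closed form.\<close>

definition mixture_msd :: "real \<Rightarrow> real \<Rightarrow> real \<Rightarrow> real \<Rightarrow> real" where
  "mixture_msd \<kappa> c b z = ((z * c)\<^sup>2 + 2 * (\<kappa> + 1) * (z * c) + \<kappa> * (\<kappa> + 1)) / b\<^sup>2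
     - 2 * z * (\<kappa> + z * c) / b + z\<^sup>2"

lemma nn_integral_mixture_msd:
  assumes pos: "0 < \<kappa>" "0 < c" "0 < b" and z: "0 \<le> z"
  shows "(\<integral>\<^sup>+y. ennreal ((y - z)\<^sup>2 * gamma_mixture \<kappa> c b z y) \<partial>lborel) = ennreal (mixture_msd \<kappa> c b z)"
proof -
  \<comment> \<open>Given \<open>i\<close> extra shape units, \<open>m i\<close> is the mean square
    distance of the gamma law from \<open>z\<close>. It is quadratic in \<open>i\<close>, so its
    average uses the Poisson moments up to order two.\<close>
  define m where "m i = (\<kappa> + real i) * (\<kappa> + real i + 1) / b\<^sup>2 - 2 * z * (\<kappa> + real i) / b + z\<^sup>2" for i
  have m_nonneg: "0 \<le> m i" for i
  proof -
    have "m i = ((\<kappa> + real i) / b - z)\<^sup>2 + (\<kappa> + real i) / b\<^sup>2"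
      using pos by (simp add: m_def power2_eq_square field_simps)
    then show ?thesis using pos by simp
  qed
  have "(\<integral>\<^sup>+y. ennreal ((y - z)\<^sup>2 * gamma_mixture \<kappa> c b z y) \<partial>lborel) =
      (\<Sum>i. ennreal (poi i (z * c)) * ennreal (m i))"
    using pos by (subst nn_integral_gamma_mixture[OF pos z])
      (auto simp: nn_integral_gamma_dens_square m_def)
  also have "\<dots> = (\<Sum>i. ennreal (poi i (z * c) * m i))"
    using pos z by (intro suminf_cong ennreal_mult[symmetric] poi_nonneg m_nonneg) auto
  also have "\<dots> = ennreal (mixture_msd \<kappa> c b z)"
  proof (rule suminf_ennreal_eq)
    show "0 \<le> poi i (z * c) * m i" for i
      using pos z by (intro mult_nonneg_nonneg poi_nonneg m_nonneg) auto
    let ?l = "z * c"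
    have "(\<lambda>i. 1 / b\<^sup>2 * ((real i)\<^sup>2 * poi i ?l) + ((2 * \<kappa> + 1) / b\<^sup>2 - 2 * z / b) * (real i * poi i ?l)
        + (\<kappa> * (\<kappa> + 1) / b\<^sup>2 - 2 * z * \<kappa> / b + z\<^sup>2) * poi i ?l) sums
        (1 / b\<^sup>2 * (?l\<^sup>2 + ?l) + ((2 * \<kappa> + 1) / b\<^sup>2 - 2 * z / b) * ?l
        + (\<kappa> * (\<kappa> + 1) / b\<^sup>2 - 2 * z * \<kappa> / b + z\<^sup>2) * 1)"
      by (intro sums_add sums_mult poi_sums poi_mean_sums poi_square_sums)
    also have "(\<lambda>i. 1 / b\<^sup>2 * ((real i)\<^sup>2 * poi i ?l) + ((2 * \<kappa> + 1) / b\<^sup>2 - 2 * z / b) * (real i * poi i ?l)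
        + (\<kappa> * (\<kappa> + 1) / b\<^sup>2 - 2 * z * \<kappa> / b + z\<^sup>2) * poi i ?l) = (\<lambda>i. poi i ?l * m i)"
      using pos by (simp add: fun_eq_iff m_def power2_eq_square field_simps)
    also have "1 / b\<^sup>2 * (?l\<^sup>2 + ?l) + ((2 * \<kappa> + 1) / b\<^sup>2 - 2 * z / b) * ?l
        + (\<kappa> * (\<kappa> + 1) / b\<^sup>2 - 2 * z * \<kappa> / b + z\<^sup>2) * 1 = mixture_msd \<kappa> c b z"
      using pos by (simp add: mixture_msd_def power2_eq_square field_simps)
    finally show "(\<lambda>i. poi i ?l * m i) sums mixture_msd \<kappa> c b z" .
  qed
  finally show ?thesis .
qed

section \<open>Mixtures over an initial distribution\<close>

lemma emeasure_density_lborel: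
  fixes d :: "real \<Rightarrow> real"
  assumes d: "integrable lborel d" "\<And>y. 0 \<le> d y" and A: "A \<in> sets borel"
  shows "emeasure (density lborel (\<lambda>y. ennreal (d y))) A = ennreal (\<integral>y. indicator A y * d y \<partial>lborel)"
proof -
  have "emeasure (density lborel (\<lambda>y. ennreal (d y))) A = (\<integral>\<^sup>+y. ennreal (d y) * indicator A y \<partial>lborel)"
    using A d(1) by (intro emeasure_density) auto
  also have "\<dots> = (\<integral>\<^sup>+y. ennreal (indicator A y * d y) \<partial>lborel)"
    by (intro nn_integral_cong) (auto split: split_indicator)
  also have "\<dots> = ennreal (\<integral>y. indicator A y * d y \<partial>lborel)"
    using d integrable_mult_indicator[of A lborel d] A by (intro nn_integral_eq_integral) auto
  finally show ?thesis .
qed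

lemma cdf_density_lborel:
  fixes d :: "real \<Rightarrow> real"
  assumes "integrable lborel d" "\<And>y. 0 \<le> d y"
  shows "cdf (density lborel (\<lambda>y. ennreal (d y))) x = (\<integral>y. indicator {..x} y * d y \<partial>lborel)"
  unfolding cdf_def measure_def using emeasure_density_lborel[OF assms, of "{..x}"] assms(2)
  by (simp add: integral_nonneg_AE)

text \<open>Tonelli shows that the joint density of \<open>y\<close> and \<open>z\<close> has mass
  1; Fubini then exchanges the two integrals. Asking for unit mass only at almost every
  \<open>z\<close> allows a kernel that is cut off at negative \<open>z\<close>.\<close>

lemma
  fixes K :: "real \<Rightarrow> real \<Rightarrow> real"
  assumes N: "real_distribution N"
    and K: "(\<lambda>(z, y). K z y) \<in> borel_measurable (borel \<Otimes>\<^sub>M borel)"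
    and nonneg: "\<And>z y. 0 \<le> K z y"
    and mass: "AE z in N. has_bochner_integral lborel (K z) 1"
  shows integrable_mixture: "integrable lborel (\<lambda>y. \<integral>z. K z y \<partial>N)"
    and real_distribution_mixture: "real_distribution (density lborel (\<lambda>y. ennreal (\<integral>z. K z y \<partial>N)))"
    and cdf_mixture: "cdf (density lborel (\<lambda>y. ennreal (\<integral>z. K z y \<partial>N))) x =
      (\<integral>z. (\<integral>y. indicator {..x} y * K z y \<partial>lborel) \<partial>N)"
proof -
  interpret N: real_distribution N by (rule N)
  interpret P: pair_sigma_finite lborel N ..
  define f where "f = (\<lambda>(y, z). K z y)"
  have f_meas [measurable]: "f \<in> borel_measurable (lborel \<Otimes>\<^sub>M N)"
  proof -
    have "(\<lambda>p. (snd p, fst p)) \<in> lborel \<Otimes>\<^sub>M N \<rightarrow>\<^sub>M borel \<Otimes>\<^sub>M borel"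
      by (intro measurable_Pair) (simp_all add: measurable_cong_sets[OF refl N.events_eq_borel, symmetric])
    from measurable_compose[OF this K] show ?thesis
      by (simp add: f_def case_prod_unfold)
  qed
  have nn1: "AE z in N. (\<integral>\<^sup>+y. ennreal (f (y, z)) \<partial>lborel) = 1"
    using mass
  proof eventually_elim
    case (elim z)
    then show ?case
      using nonneg nn_integral_eq_integral[of lborel "K z"]
      by (auto simp: f_def has_bochner_integral_iff)
  qed
  have "(\<integral>\<^sup>+p. ennreal (f p) \<partial>(lborel \<Otimes>\<^sub>M N)) = (\<integral>\<^sup>+z. (\<integral>\<^sup>+y. ennreal (f (y, z)) \<partial>lborel) \<partial>N)"
    by (subst P.nn_integral_snd[symmetric]) auto
  also have "\<dots> = (\<integral>\<^sup>+z. 1 \<partial>N)"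
    by (rule nn_integral_cong_AE[OF nn1])
  also have "\<dots> = 1"
    using N.emeasure_space_1 by simp
  finally have f_int: "integrable (lborel \<Otimes>\<^sub>M N) f"
    by (intro integrableI_nn_integral_finite[of _ _ 1] f_meas) (simp_all add: f_def case_prod_unfold nonneg)
  define d where "d y = (\<integral>z. K z y \<partial>N)" for y
  have d_nonneg: "0 \<le> d y" for y
    unfolding d_def by (intro integral_nonneg_AE AE_I2 nonneg)
  show d_int: "integrable lborel (\<lambda>y. \<integral>z. K z y \<partial>N)"
    using P.integrable_fst'[OF f_int] by (simp add: f_def)
  then have d_int': "integrable lborel d"
    by (simp add: d_def[abs_def])
  have fubini: "(\<integral>y. indicator A y * d y \<partial>lborel) = (\<integral>z. (\<integral>y. indicator A y * K z y \<partial>lborel) \<partial>N)"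
    if A: "A \<in> sets borel" for A
  proof -
    have "A \<times> UNIV \<in> sets (lborel \<Otimes>\<^sub>M N)"
      using A by (intro pair_measureI) auto
    then have "integrable (lborel \<Otimes>\<^sub>M N) (\<lambda>p. indicator (A \<times> UNIV) p *\<^sub>R f p)"
      using f_int by (intro integrable_mult_indicator)
    also have "(\<lambda>p. indicator (A \<times> UNIV) p *\<^sub>R f p) = (\<lambda>(y, z). indicator A y * K z y)"
      by (auto simp: fun_eq_iff f_def indicator_def)
    finally show ?thesis
      using P.Fubini_integral[of "\<lambda>y z. indicator A y * K z y"] by (simp add: d_def)
  qed
  note emeasure = emeasure_density_lborel[OF d_int' d_nonneg]
  have "(\<integral>z. (\<integral>y. indicator UNIV y * K z y \<partial>lborel) \<partial>N) = (\<integral>z. 1 \<partial>N)"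
    using mass P.integrable_fst' f_int N
    by (intro integral_cong_AE) (auto simp: has_bochner_integral_iff elim!: eventually_mono
        intro!: borel_measurable_integrable[OF P.integrable_snd[of "\<lambda>y z. K z y"]] simp: f_def)
  then have "emeasure (density lborel (\<lambda>y. ennreal (d y))) UNIV = 1"
    using emeasure[of UNIV] fubini[of UNIV] N.prob_space by simp
  then have "prob_space (density lborel (\<lambda>y. ennreal (d y)))"
    by (intro prob_spaceI) simp
  then show "real_distribution (density lborel (\<lambda>y. ennreal (\<integral>z. K z y \<partial>N)))"
    by (simp add: real_distribution_def real_distribution_axioms_def d_def)
  show "cdf (density lborel (\<lambda>y. ennreal (\<integral>z. K z y \<partial>N))) x =
      (\<integral>z. (\<integral>y. indicator {..x} y * K z y \<partial>lborel) \<partial>N)"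
    using cdf_density_lborel[OF d_int' d_nonneg] fubini[of "{..x}"] by (simp add: d_def)
qed

section \<open>Distribution function of the mixture with a fixed starting point\<close>

definition mixture_cdf :: "real \<Rightarrow> real \<Rightarrow> real \<Rightarrow> real \<Rightarrow> real \<Rightarrow> real" where
  "mixture_cdf \<kappa> c b z x = (\<integral>y. indicator {..x} y * gamma_mixture \<kappa> c b z y \<partial>lborel)"

text \<open>Squared bias plus variance: the mean is \<open>(\<kappa> + z * c) / b\<close>, and the
  variance is the averaged gamma variance \<open>(\<kappa> + z * c) / b^2\<close> plus the
  contribution \<open>z * c / b^2\<close> of the Poisson number.\<close>

lemma mixture_msd_eq:
  assumes "b > 0"
  shows "mixture_msd \<kappa> c b z = ((\<kappa> + z * c) / b - z)\<^sup>2 + (\<kappa> + 2 * (z * c)) / b\<^sup>2"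
  using assms by (simp add: mixture_msd_def power2_eq_square field_simps)

context
  fixes \<kappa> c b z :: real
  assumes pos: "0 < \<kappa>" "0 < c" "0 < b" "0 \<le> z"
begin

lemma integrable_mixture_indicator:
  "A \<in> sets borel \<Longrightarrow> integrable lborel (\<lambda>y. indicator A y * gamma_mixture \<kappa> c b z y)"
  using has_bochner_integral_gamma_mixture[OF pos]
    integrable_mult_indicator[of A lborel "gamma_mixture \<kappa> c b z"]
  by (simp add: has_bochner_integral_iff)

lemma mixture_cdf_bounds: "0 \<le> mixture_cdf \<kappa> c b z x" "mixture_cdf \<kappa> c b z x \<le> 1"
proof -
  have mix: "integrable lborel (gamma_mixture \<kappa> c b z)" "integral\<^sup>L lborel (gamma_mixture \<kappa> c b z) = 1"
    using has_bochner_integral_gamma_mixture[OF pos] by (auto simp: has_bochner_integral_iff)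
  show "0 \<le> mixture_cdf \<kappa> c b z x"
    unfolding mixture_cdf_def using gamma_mixture_nonneg[OF pos]
    by (intro integral_nonneg_AE AE_I2 mult_nonneg_nonneg) auto
  have "mixture_cdf \<kappa> c b z x \<le> integral\<^sup>L lborel (gamma_mixture \<kappa> c b z)"
    unfolding mixture_cdf_def using gamma_mixture_nonneg[OF pos]
    by (intro integral_mono integrable_mixture_indicator mix) (auto split: split_indicator)
  then show "mixture_cdf \<kappa> c b z x \<le> 1"
    by (simp add: mix)
qed

lemma has_bochner_integral_mixture_msd:
  "has_bochner_integral lborel (\<lambda>y. (y - z)\<^sup>2 * gamma_mixture \<kappa> c b z y) (mixture_msd \<kappa> c b z)"
proof (rule has_bochner_integral_nn_integral)
  show "AE y in lborel. 0 \<le> (y - z)\<^sup>2 * gamma_mixture \<kappa> c b z y"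
    using gamma_mixture_nonneg[OF pos] by simp
  show "0 \<le> mixture_msd \<kappa> c b z"
    using pos by (simp add: mixture_msd_eq)
  show "(\<integral>\<^sup>+y. ennreal ((y - z)\<^sup>2 * gamma_mixture \<kappa> c b z y) \<partial>lborel) = ennreal (mixture_msd \<kappa> c b z)"
    by (rule nn_integral_mixture_msd[OF pos])
  show "(\<lambda>y. (y - z)\<^sup>2 * gamma_mixture \<kappa> c b z y) \<in> borel_measurable lborel"
    by (intro borel_measurable_times borel_measurable_power borel_measurable_diff)
       (simp_all add: gamma_mixture_measurable_snd[OF pos(1-3)])
qed

text \<open>Chebyshev's inequality.\<close>

lemma mixture_cdf_concentration:
  assumes "x \<noteq> z"
  shows "\<bar>mixture_cdf \<kappa> c b z x - of_bool (z \<le> x)\<bar> \<le> mixture_msd \<kappa> c b z / (z - x)\<^sup>2"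
proof -
  let ?f = "gamma_mixture \<kappa> c b z"
  have mix: "integrable lborel ?f" "integral\<^sup>L lborel ?f = 1"
    using has_bochner_integral_gamma_mixture[OF pos] by (auto simp: has_bochner_integral_iff)
  have int: "integrable lborel (\<lambda>y. indicator {..x} y * ?f y - of_bool (z \<le> x) * ?f y)"
    by (intro Bochner_Integration.integrable_diff integrable_mixture_indicator integrable_mult_right mix) simp
  have pointwise: "\<bar>indicator {..x} y * ?f y - of_bool (z \<le> x) * ?f y\<bar> \<le> (y - z)\<^sup>2 * ?f y / (z - x)\<^sup>2" for y
  proof -
    have f: "0 \<le> ?f y" by (rule gamma_mixture_nonneg[OF pos])
    show ?thesis
    proof (cases "(y \<le> x) = (z \<le> x)")
      case True
      then show ?thesis using f by (auto simp: indicator_def)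
    next
      case False
      \<comment> \<open>The indicators differ only when \<open>x\<close> separates \<open>y\<close>
        from \<open>z\<close>.\<close>
      then have "\<bar>z - x\<bar> \<le> \<bar>y - z\<bar>" by auto
      then have "(z - x)\<^sup>2 \<le> (y - z)\<^sup>2"
        by (simp add: abs_le_square_iff)
      then have "(z - x)\<^sup>2 * ?f y \<le> (y - z)\<^sup>2 * ?f y"
        by (intro mult_right_mono f)
      moreover have "\<bar>indicator {..x} y * ?f y - of_bool (z \<le> x) * ?f y\<bar> = ?f y"
        using False f by (auto simp: indicator_def)
      ultimately show ?thesis
        using \<open>x \<noteq> z\<close> by (simp add: field_simps)
    qed
  qed
  have msd_int: "integrable lborel (\<lambda>y. (y - z)\<^sup>2 * ?f y / (z - x)\<^sup>2)"
    by (intro integrable_divide_zero impI integrable.intros[OF has_bochner_integral_mixture_msd])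
  have eq: "mixture_cdf \<kappa> c b z x - of_bool (z \<le> x) =
      (\<integral>y. indicator {..x} y * ?f y - of_bool (z \<le> x) * ?f y \<partial>lborel)"
    unfolding mixture_cdf_def
    by (subst Bochner_Integration.integral_diff)
       (auto intro!: integrable_mixture_indicator integrable_mult_right mix simp: mix(2))
  have "\<bar>mixture_cdf \<kappa> c b z x - of_bool (z \<le> x)\<bar> \<le> (\<integral>y. \<bar>indicator {..x} y * ?f y - of_bool (z \<le> x) * ?f y\<bar> \<partial>lborel)"
    unfolding eq by (rule integral_abs_bound)
  also have "\<dots> \<le> (\<integral>y. (y - z)\<^sup>2 * ?f y / (z - x)\<^sup>2 \<partial>lborel)"
    by (rule integral_mono[OF integrable_abs[OF int] msd_int pointwise])
  also have "\<dots> = mixture_msd \<kappa> c b z / (z - x)\<^sup>2"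
    by (simp only: integral_divide_zero has_bochner_integral_integral_eq[OF has_bochner_integral_mixture_msd])
  finally show ?thesis .
qed

text \<open>The term \<open>i = 0\<close> is the gamma density itself with weight
  \<open>exp (- (z * c))\<close>; all other terms together have mass
  \<open>1 - exp (- (z * c))\<close>.\<close>

lemma mixture_cdf_near_gamma:
  fixes x :: real
  defines "G \<equiv> (\<integral>y. indicator {..x} y * gamma_dens y \<kappa> b \<partial>lborel)"
  shows "exp (- (z * c)) * G \<le> mixture_cdf \<kappa> c b z x"
    and "mixture_cdf \<kappa> c b z x \<le> exp (- (z * c)) * G + (1 - exp (- (z * c)))"
proof -
  define e where "e = exp (- (z * c))"
  let ?f = "gamma_mixture \<kappa> c b z" and ?g = "\<lambda>y. gamma_dens y \<kappa> b"
  have mix: "integrable lborel ?f" "integral\<^sup>L lborel ?f = 1"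
    using has_bochner_integral_gamma_mixture[OF pos] by (auto simp: has_bochner_integral_iff)
  have gam: "integrable lborel ?g" "integral\<^sup>L lborel ?g = 1"
    using has_bochner_integral_gamma_dens[OF pos(1,3)] by (auto simp: has_bochner_integral_iff)
  have gam_ind: "integrable lborel (\<lambda>y. indicator {..x} y * ?g y)"
    using integrable_mult_indicator[of "{..x}" lborel ?g] gam by simp
  have diff: "e * ?g y \<le> ?f y" for y
  proof -
    have "(\<Sum>i\<in>{0}. poi i (z * c) * gamma_dens y (\<kappa> + real i) b) \<le> ?f y"
      unfolding gamma_mixture_def
      using gamma_mixture_summable[OF pos] gamma_mixture_term_nonneg[OF pos]
      by (intro sum_le_suminf) auto
    then show ?thesis
      by (simp add: poi_def e_def)
  qed
  have eq: "mixture_cdf \<kappa> c b z x - e * G = (\<integral>y. indicator {..x} y * ?f y - e * (indicator {..x} y * ?g y) \<partial>lborel)"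
    unfolding mixture_cdf_def G_def
    by (subst Bochner_Integration.integral_diff)
       (auto intro!: integrable_mixture_indicator integrable_mult_right gam_ind)
  have "0 \<le> mixture_cdf \<kappa> c b z x - e * G"
    unfolding eq using diff by (intro integral_nonneg_AE AE_I2) (auto split: split_indicator)
  then show "exp (- (z * c)) * G \<le> mixture_cdf \<kappa> c b z x"
    by (simp add: e_def)
  have "mixture_cdf \<kappa> c b z x - e * G \<le> (\<integral>y. ?f y - e * ?g y \<partial>lborel)"
    unfolding eq
    by (intro integral_mono Bochner_Integration.integrable_diff integrable_mixture_indicator
        integrable_mult_right gam_ind mix gam) (use diff in \<open>auto split: split_indicator\<close>)
  also have "\<dots> = 1 - e"
    by (subst Bochner_Integration.integral_diff) (auto intro!: integrable_mult_right gam mix simp: mix gam)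
  finally show "mixture_cdf \<kappa> c b z x \<le> exp (- (z * c)) * G + (1 - exp (- (z * c)))"
    by (simp add: e_def)
qed

end

section \<open>Limits of the mixtures\<close>

lemma tau_pos: "0 < \<alpha> \<Longrightarrow> 0 < t \<Longrightarrow> 0 < tau \<alpha> t"
  by (simp add: tau_def)

text \<open>\<open>tau\<close> blows up as \<open>t\<close> tends to 0. These two quotients stay
  bounded, and the mean square distance is a polynomial in them.\<close>

lemma inverse_tau_add:
  assumes "0 < \<alpha>" "0 < t"
  shows "1 / (tau \<alpha> t + \<alpha>) = (1 - exp (- (\<alpha> * t))) / \<alpha>"
    and "tau \<alpha> t / (tau \<alpha> t + \<alpha>) = exp (- (\<alpha> * t))"
proof -
  define e where "e = exp (\<alpha> * t)"
  have e: "e > 1" "exp (- (\<alpha> * t)) = 1 / e"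
    using assms by (auto simp: e_def exp_minus field_simps)
  have sum: "tau \<alpha> t + \<alpha> = \<alpha> * e / (e - 1)"
    using e by (simp add: tau_def e_def[symmetric] field_simps)
  show "1 / (tau \<alpha> t + \<alpha>) = (1 - exp (- (\<alpha> * t))) / \<alpha>"
    unfolding sum e(2) using e(1) assms by (simp add: field_simps)
  show "tau \<alpha> t / (tau \<alpha> t + \<alpha>) = exp (- (\<alpha> * t))"
    unfolding sum e(2) using e(1) assms by (simp add: tau_def e_def[symmetric] field_simps)
qed

text \<open>With \<open>s = 1 / b\<close> tending to 0 and \<open>r = c / b\<close> tending to 1,
  the mean tends to \<open>z\<close> and the variance has the factor \<open>s\<close>.\<close>

lemma mixture_msd_tendsto_0:
  assumes "0 < \<alpha>" "\<And>n. 0 < S n" "S \<longlonglongrightarrow> 0"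
  shows "(\<lambda>n. mixture_msd \<kappa> (tau \<alpha> (S n)) (tau \<alpha> (S n) + \<alpha>) z) \<longlonglongrightarrow> 0"
proof -
  define r where "r n = exp (- (\<alpha> * S n))" for n
  define s where "s n = (1 - r n) / \<alpha>" for n
  have r: "r \<longlonglongrightarrow> exp (- (\<alpha> * 0))"
    unfolding r_def by (intro tendsto_intros assms)
  then have s: "s \<longlonglongrightarrow> (1 - 1) / \<alpha>"
    unfolding s_def using assms by (intro tendsto_intros) auto
  have "mixture_msd \<kappa> (tau \<alpha> (S n)) (tau \<alpha> (S n) + \<alpha>) z =
      (\<kappa> * s n + z * r n - z)\<^sup>2 + (\<kappa> * s n + 2 * (z * r n)) * s n" for n
  proof -
    define c where "c = tau \<alpha> (S n)"
    define b where "b = c + \<alpha>"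
    have "b > 0" using tau_pos[OF assms(1) assms(2)[of n]] assms(1) by (simp add: b_def c_def)
    have sr: "s n = 1 / b" "r n = c / b"
      using inverse_tau_add[OF assms(1,2)] by (auto simp: s_def r_def b_def c_def)
    show ?thesis
      unfolding c_def[symmetric] b_def[symmetric] mixture_msd_eq[OF \<open>b > 0\<close>] sr
      by (simp add: power2_eq_square add_divide_distrib ring_distribs)
  qed
  moreover have "(\<lambda>n. (\<kappa> * s n + z * r n - z)\<^sup>2 + (\<kappa> * s n + 2 * (z * r n)) * s n) \<longlonglongrightarrow>
      (\<kappa> * ((1 - 1) / \<alpha>) + z * exp (- (\<alpha> * 0)) - z)\<^sup>2 +
      (\<kappa> * ((1 - 1) / \<alpha>) + 2 * (z * exp (- (\<alpha> * 0)))) * ((1 - 1) / \<alpha>)"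
    by (intro tendsto_intros r s)
  ultimately show ?thesis by simp
qed

text \<open>Chebyshev's bound with vanishing mean square distance. The point \<open>x = z\<close> is
  left out because the limit jumps there.\<close>

lemma mixture_cdf_tendsto_start:
  assumes "0 < \<kappa>" "0 < \<alpha>" "\<And>n. 0 < S n" "S \<longlonglongrightarrow> 0" "0 \<le> z" "x \<noteq> z"
  shows "(\<lambda>n. mixture_cdf \<kappa> (tau \<alpha> (S n)) (tau \<alpha> (S n) + \<alpha>) z x) \<longlonglongrightarrow> of_bool (z \<le> x)"
proof (rule LIM_zero_cancel, rule tendsto_0_le)
  show "(\<lambda>n. mixture_msd \<kappa> (tau \<alpha> (S n)) (tau \<alpha> (S n) + \<alpha>) z / (z - x)\<^sup>2) \<longlonglongrightarrow> 0"
    using tendsto_divide_zero[OF mixture_msd_tendsto_0[OF assms(2-4)]] .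
  show "\<forall>\<^sub>F n in sequentially. norm (mixture_cdf \<kappa> (tau \<alpha> (S n)) (tau \<alpha> (S n) + \<alpha>) z x - of_bool (z \<le> x))
      \<le> norm (mixture_msd \<kappa> (tau \<alpha> (S n)) (tau \<alpha> (S n) + \<alpha>) z / (z - x)\<^sup>2) * 1"
  proof (intro always_eventually allI)
    fix n
    have "0 < tau \<alpha> (S n)" "0 < tau \<alpha> (S n) + \<alpha>"
      using tau_pos[OF assms(2) assms(3)[of n]] assms(2) by auto
    from mixture_cdf_concentration[OF assms(1) this assms(5,6)]
    show "norm (mixture_cdf \<kappa> (tau \<alpha> (S n)) (tau \<alpha> (S n) + \<alpha>) z x - of_bool (z \<le> x))
      \<le> norm (mixture_msd \<kappa> (tau \<alpha> (S n)) (tau \<alpha> (S n) + \<alpha>) z / (z - x)\<^sup>2) * 1"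
      unfolding real_norm_def mult_1_right by (rule order_trans[OF _ abs_ge_self])
  qed
qed

section \<open>Long times: convergence to the gamma distribution\<close>

lemma tau_tendsto_0:
  assumes "0 < \<alpha>" "filterlim S at_top sequentially"
  shows "(\<lambda>n. tau \<alpha> (S n)) \<longlonglongrightarrow> 0"
proof -
  have "filterlim (\<lambda>n. - 1 + exp (\<alpha> * S n)) at_top sequentially"
    by (intro filterlim_tendsto_add_at_top[OF tendsto_const] filterlim_compose[OF exp_at_top]
        filterlim_tendsto_pos_mult_at_top[OF tendsto_const] assms)
  then show ?thesis
    unfolding tau_def
    by (intro tendsto_divide_0[OF tendsto_const] filterlim_at_top_imp_at_infinity) simp
qed

text \<open>The rates \<open>b n\<close> lie between \<alpha> and a bound \<open>B\<close>. The
  lower bound controls the exponential and the upper one the power, so a multiple of the density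
  with rate \<alpha> is a majorant.\<close>

lemma gamma_cdf_tendsto:
  assumes "0 < \<kappa>" "0 < \<alpha>" "\<And>n. \<alpha> \<le> b n" "b \<longlonglongrightarrow> \<alpha>"
  shows "(\<lambda>n. \<integral>y. indicator {..x} y * gamma_dens y \<kappa> (b n) \<partial>lborel) \<longlonglongrightarrow>
         (\<integral>y. indicator {..x} y * gamma_dens y \<kappa> \<alpha> \<partial>lborel)"
proof -
  have "Bseq b"
    using assms(4) by (rule convergent_imp_Bseq[OF convergentI])
  then obtain B where "B > 0" and B': "\<And>n. \<bar>b n\<bar> \<le> B"
    by (auto elim!: BseqE)
  have B: "b n \<le> B" for n
    using B'[of n] by simp
  have G: "0 < Gamma \<kappa>" using assms by (simp add: Gamma_real_pos)
  show ?thesis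
  proof (rule integral_dominated_convergence[where w="\<lambda>y. (B / \<alpha>) powr \<kappa> * gamma_dens y \<kappa> \<alpha>"])
    show "integrable lborel (\<lambda>y. (B / \<alpha>) powr \<kappa> * gamma_dens y \<kappa> \<alpha>)"
      using has_bochner_integral_gamma_dens[OF assms(1,2)]
      by (intro integrable_mult_right) (simp add: has_bochner_integral_iff)
    show "AE y in lborel. (\<lambda>n. indicator {..x} y * gamma_dens y \<kappa> (b n)) \<longlonglongrightarrow>
        indicator {..x} y * gamma_dens y \<kappa> \<alpha>"
      unfolding gamma_dens_def using assms(2) G
      by (intro AE_I2) (auto intro!: tendsto_intros assms(4))
    show "AE y in lborel. norm (indicator {..x} y * gamma_dens y \<kappa> (b n)) \<le>
        (B / \<alpha>) powr \<kappa> * gamma_dens y \<kappa> \<alpha>" for n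
    proof (intro AE_I2)
      fix y
      have b: "0 < b n" using assms(2) assms(3)[of n] by simp
      have le: "gamma_dens y \<kappa> (b n) \<le> (B / \<alpha>) powr \<kappa> * gamma_dens y \<kappa> \<alpha>"
      proof (cases "y > 0")
        case True
        have "b n powr \<kappa> \<le> B powr \<kappa>"
          using b B assms(1) by (intro powr_mono2) auto
        moreover have "exp (- b n * y) \<le> exp (- \<alpha> * y)"
          using assms(3)[of n] True by simp
        ultimately have "b n powr \<kappa> * exp (- b n * y) \<le> B powr \<kappa> * exp (- \<alpha> * y)"
          by (intro mult_mono) auto
        then have "y powr (\<kappa> - 1) * (b n powr \<kappa> * exp (- b n * y) / Gamma \<kappa>) \<le>
            y powr (\<kappa> - 1) * (B powr \<kappa> * exp (- \<alpha> * y) / Gamma \<kappa>)"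
          using G by (intro mult_left_mono divide_right_mono) auto
        also have "B powr \<kappa> = (B / \<alpha>) powr \<kappa> * \<alpha> powr \<kappa>"
          using \<open>B > 0\<close> assms(2) by (simp add: powr_mult[symmetric])
        finally show ?thesis
          using True by (simp add: gamma_dens_def mult_ac)
      qed (simp add: gamma_dens_nonpos)
      have "0 \<le> gamma_dens y \<kappa> (b n)"
        using assms(1) b by (rule gamma_dens_nonneg)
      with le show "norm (indicator {..x} y * gamma_dens y \<kappa> (b n)) \<le> (B / \<alpha>) powr \<kappa> * gamma_dens y \<kappa> \<alpha>"
        by (auto split: split_indicator)
    qed
  qed auto
qed

text \<open>As \<open>c\<close> tends to 0 the Poisson number vanishes, so both bounds of
  \<open>mixture_cdf_near_gamma\<close> tend to the gamma distribution function, whatever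
  \<open>z\<close> is.\<close>

lemma mixture_cdf_tendsto_infinity:
  assumes "0 < \<kappa>" "0 < \<alpha>" "\<And>n. 0 < S n" "filterlim S at_top sequentially" "0 \<le> z"
  shows "(\<lambda>n. mixture_cdf \<kappa> (tau \<alpha> (S n)) (tau \<alpha> (S n) + \<alpha>) z x) \<longlonglongrightarrow>
         (\<integral>y. indicator {..x} y * gamma_dens y \<kappa> \<alpha> \<partial>lborel)"
proof -
  define c where "c n = tau \<alpha> (S n)" for n
  define b where "b n = c n + \<alpha>" for n
  define G where "G n = (\<integral>y. indicator {..x} y * gamma_dens y \<kappa> (b n) \<partial>lborel)" for n
  let ?G = "\<integral>y. indicator {..x} y * gamma_dens y \<kappa> \<alpha> \<partial>lborel"
  have c_pos: "0 < c n" for n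
    unfolding c_def by (rule tau_pos[OF assms(2,3)])
  then have b_pos: "0 < b n" for n
    using assms(2) by (simp add: b_def add_pos_pos)
  have c: "c \<longlonglongrightarrow> 0"
    unfolding c_def by (rule tau_tendsto_0[OF assms(2,4)])
  have "(\<lambda>n. c n + \<alpha>) \<longlonglongrightarrow> 0 + \<alpha>"
    by (intro tendsto_intros c)
  then have b: "b \<longlonglongrightarrow> \<alpha>"
    by (simp add: b_def[abs_def])
  have "\<alpha> \<le> b n" for n
    using c_pos[of n] by (simp add: b_def)
  then have G: "G \<longlonglongrightarrow> ?G"
    unfolding G_def[abs_def] by (intro gamma_cdf_tendsto assms b)
  have e: "(\<lambda>n. exp (- (z * c n))) \<longlonglongrightarrow> exp (- (z * 0))"
    by (intro tendsto_intros c)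
  have "(\<lambda>n. mixture_cdf \<kappa> (c n) (b n) z x) \<longlonglongrightarrow> ?G"
  proof (rule tendsto_sandwich)
    show "\<forall>\<^sub>F n in sequentially. exp (- (z * c n)) * G n \<le> mixture_cdf \<kappa> (c n) (b n) z x"
      unfolding G_def using mixture_cdf_near_gamma(1)[OF assms(1) c_pos b_pos assms(5)] by simp
    show "\<forall>\<^sub>F n in sequentially. mixture_cdf \<kappa> (c n) (b n) z x \<le>
        exp (- (z * c n)) * G n + (1 - exp (- (z * c n)))"
      unfolding G_def using mixture_cdf_near_gamma(2)[OF assms(1) c_pos b_pos assms(5)] by simp
    show "(\<lambda>n. exp (- (z * c n)) * G n) \<longlonglongrightarrow> ?G"
      using tendsto_mult[OF e G] by simp
    show "(\<lambda>n. exp (- (z * c n)) * G n + (1 - exp (- (z * c n)))) \<longlonglongrightarrow> ?G"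
      using tendsto_add[OF tendsto_mult[OF e G] tendsto_diff[OF tendsto_const e, of 1]] by simp
  qed
  then show ?thesis
    by (simp add: b_def c_def)
qed

section \<open>The degree distributions\<close>

text \<open>Turns the integral with respect to \<open>deg_distr0 W\<close> in
  \<open>deg_dens\<close> into one against \<open>degree_law W\<close>.\<close>

lemma interval_measure_cdf:
  assumes "real_distribution M"
  shows "interval_measure (cdf M) = M"
proof (rule cdf_unique)
  interpret real_distribution M by (rule assms)
  show "real_distribution M" by (rule assms)
  show "real_distribution (interval_measure (cdf M))"
    by (intro real_distribution_interval_measure cdf_nondecreasing cdf_is_right_cont
        cdf_lim_at_bot cdf_lim_at_top_prob)
  show "cdf (interval_measure (cdf M)) = cdf M"
    by (intro cdf_interval_measure cdf_nondecreasing cdf_is_right_cont cdf_lim_at_bot)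
qed

definition degree_law :: "(real \<Rightarrow> real \<Rightarrow> nat \<Rightarrow> real) \<Rightarrow> real measure" where
  "degree_law W = distr unit_lebesgue borel (mg_deg W)"

definition gamma_law :: "real \<Rightarrow> real \<Rightarrow> real measure" where
  "gamma_law a b = density lborel (\<lambda>y. ennreal (gamma_dens y a b))"

lemma gamma_law:
  assumes "0 < a" "0 < b"
  shows "real_distribution (gamma_law a b)"
    and "cdf (gamma_law a b) x = (\<integral>y. indicator {..x} y * gamma_dens y a b \<partial>lborel)"
proof -
  have int: "integrable lborel (\<lambda>y. gamma_dens y a b)"
    using has_bochner_integral_gamma_dens[OF assms] by (rule integrable.intros)
  have "emeasure (gamma_law a b) UNIV = 1"
    unfolding gamma_law_def by (subst emeasure_density) (simp_all add: nn_integral_gamma_dens[OF assms])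
  then have "prob_space (gamma_law a b)"
    by (intro prob_spaceI) (simp add: gamma_law_def)
  then show "real_distribution (gamma_law a b)"
    by (simp add: real_distribution_def real_distribution_axioms_def gamma_law_def)
  show "cdf (gamma_law a b) x = (\<integral>y. indicator {..x} y * gamma_dens y a b \<partial>lborel)"
    unfolding gamma_law_def by (rule cdf_density_lborel[OF int gamma_dens_nonneg[OF assms]])
qed

text \<open>\<open>deg_distr\<close> and \<open>mg_hat_inf\<close> integrate from 0,
  \<open>cdf\<close> from minus infinity.\<close>

lemma set_integral_half_line:
  fixes f :: "real \<Rightarrow> real"
  assumes "\<And>y. y \<le> 0 \<Longrightarrow> f y = 0"
  shows "(LINT y:{0..x}|lborel. f y) = (\<integral>y. indicator {..x} y * f y \<partial>lborel)"
  unfolding set_lebesgue_integral_def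
  by (intro Bochner_Integration.integral_cong refl) (use assms in \<open>auto simp: indicator_def not_le\<close>)

lemma indicator_integral_nonpos:
  fixes f :: "real \<Rightarrow> real"
  assumes "\<And>y. y \<le> 0 \<Longrightarrow> f y = 0" "x < 0"
  shows "(\<integral>y. indicator {..x} y * f y \<partial>lborel) = 0"
proof -
  have "(\<lambda>y. indicator {..x} y * f y) = (\<lambda>_. 0)"
    using assms by (auto simp: fun_eq_iff indicator_def)
  then show ?thesis by simp
qed

definition evolved_law :: "real \<Rightarrow> (real \<Rightarrow> real \<Rightarrow> nat \<Rightarrow> real) \<Rightarrow> real \<Rightarrow> real measure" where
  "evolved_law \<kappa> W t = density lborel (\<lambda>y. ennreal (\<integral>z. indicator {0..} z * fker \<kappa> (mg_dens W) t z y \<partial>degree_law W))"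

context
  fixes \<kappa> :: real and W :: "real \<Rightarrow> real \<Rightarrow> nat \<Rightarrow> real"
  assumes \<kappa>: "0 < \<kappa>" and W: "multigraphon W" and dens: "0 < mg_dens W"
begin

private abbreviation (input) "\<alpha> \<equiv> \<kappa> / mg_dens W"
private abbreviation (input) "N \<equiv> degree_law W"

lemma alpha_pos: "0 < \<alpha>"
  using \<kappa> dens by simp

lemma mg_deg_meas: "mg_deg W \<in> borel_measurable unit_lebesgue"
  by (intro mg_deg_measurable multigraphon_slicewise_measurable W)

lemma real_distribution_degree_law: "real_distribution N"
  unfolding degree_law_def by (rule unit.real_distribution_distr[OF mg_deg_meas])

lemma AE_degree_law_nonneg: "AE z in N. 0 \<le> z"
  unfolding degree_law_def using mg_deg_meas mg_deg_nonneg by (subst AE_distr_iff) auto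

lemma deg_distr0_eq_cdf: "deg_distr0 W = cdf N"
proof
  fix x
  have "deg_distr0 W x = (\<integral>y. of_bool (mg_deg W y \<le> x) \<partial>unit_lebesgue)"
    by (simp add: deg_distr0_def unit_lebesgue_def set_lebesgue_integral_def integral_restrict_space)
  also have "\<dots> = (\<integral>y. indicator {y \<in> {0..1}. mg_deg W y \<le> x} y \<partial>unit_lebesgue)"
    by (intro Bochner_Integration.integral_cong refl) (auto simp: indicator_def)
  also have "\<dots> = measure unit_lebesgue {y \<in> {0..1}. mg_deg W y \<le> x}"
    by simp (intro arg_cong[where f="measure unit_lebesgue"], auto)
  also have "\<dots> = cdf N x"
    unfolding cdf_def degree_law_def using mg_deg_meas
    by (subst measure_distr) (auto intro!: arg_cong[where f="measure unit_lebesgue"])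
  finally show "deg_distr0 W x = cdf N x" .
qed

lemma deg_dens_eq: "deg_dens \<kappa> W t y = (\<integral>z. indicator {0..} z * fker \<kappa> (mg_dens W) t z y \<partial>N)"
  unfolding deg_dens_def deg_distr0_eq_cdf interval_measure_cdf[OF real_distribution_degree_law]
  by (simp add: set_lebesgue_integral_def)

lemma
  assumes t: "0 < t"
  shows real_distribution_evolved_law: "real_distribution (evolved_law \<kappa> W t)"
    and cdf_evolved_law: "cdf (evolved_law \<kappa> W t) x =
      (\<integral>z. indicator {0..} z * mixture_cdf \<kappa> (tau \<alpha> t) (tau \<alpha> t + \<alpha>) z x \<partial>N)"
    and deg_distr_eq_cdf: "deg_distr \<kappa> W t = cdf (evolved_law \<kappa> W t)"
    and cdf_evolved_law_neg: "x < 0 \<Longrightarrow> cdf (evolved_law \<kappa> W t) x = 0"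
proof -
  define c where "c = tau \<alpha> t"
  define b where "b = c + \<alpha>"
  have pos: "0 < c" "0 < b"
    using tau_pos[OF alpha_pos t] alpha_pos by (auto simp: b_def c_def)
  \<comment> \<open>Cutting off negative \<open>z\<close>, where Poisson weights can be negative,
    makes the kernel nonnegative everywhere. The degree law does not charge such \<open>z\<close>,
    so the unit mass holds almost everywhere.\<close>
  define K where "K z y = indicator {0..} z * gamma_mixture \<kappa> c b z y" for z y :: real
  have fker: "indicator {0..} z * fker \<kappa> (mg_dens W) t z y = K z y" for z y
    by (simp add: K_def fker_eq_gamma_mixture b_def c_def)
  have K_meas: "(\<lambda>(z, y). K z y) \<in> borel_measurable (borel \<Otimes>\<^sub>M borel)"
    using gamma_mixture_measurable[OF \<kappa> pos] unfolding K_def case_prod_unfold by measurable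
  have K_nonneg: "0 \<le> K z y" for z y
    using gamma_mixture_nonneg[OF \<kappa> pos] by (auto simp: K_def indicator_def)
  have K_mass: "AE z in N. has_bochner_integral lborel (K z) 1"
    using AE_degree_law_nonneg
  proof eventually_elim
    case (elim z)
    then have "K z = gamma_mixture \<kappa> c b z"
      by (simp add: K_def fun_eq_iff)
    then show ?case
      using has_bochner_integral_gamma_mixture[OF \<kappa> pos elim] by simp
  qed
  have law: "evolved_law \<kappa> W t = density lborel (\<lambda>y. ennreal (\<integral>z. K z y \<partial>N))"
    by (simp add: evolved_law_def fker)
  show "real_distribution (evolved_law \<kappa> W t)"
    unfolding law by (rule real_distribution_mixture[OF real_distribution_degree_law K_meas K_nonneg K_mass])
  have cdf: "cdf (evolved_law \<kappa> W t) x = (\<integral>z. (\<integral>y. indicator {..x} y * K z y \<partial>lborel) \<partial>N)" for x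
    unfolding law by (rule cdf_mixture[OF real_distribution_degree_law K_meas K_nonneg K_mass])
  have inner: "(\<integral>y. indicator {..x} y * K z y \<partial>lborel) = indicator {0..} z * mixture_cdf \<kappa> c b z x" for z x
    unfolding K_def mixture_cdf_def by (cases "0 \<le> z") auto
  show "cdf (evolved_law \<kappa> W t) x =
      (\<integral>z. indicator {0..} z * mixture_cdf \<kappa> (tau \<alpha> t) (tau \<alpha> t + \<alpha>) z x \<partial>N)"
    unfolding cdf inner by (simp add: b_def c_def)
  have K0: "K z y = 0" if "y \<le> 0" for z y
    using gamma_mixture_nonpos[OF \<kappa> pos that] by (simp add: K_def)
  then show "cdf (evolved_law \<kappa> W t) x = 0" if "x < 0"
    unfolding cdf using indicator_integral_nonpos[OF K0 that] by simp
  show "deg_distr \<kappa> W t = cdf (evolved_law \<kappa> W t)"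
  proof
    fix x
    define d where "d y = (\<integral>z. K z y \<partial>N)" for y
    have d: "d y = 0" if "y \<le> 0" for y
      using K0[OF that] by (simp add: d_def)
    have d_nonneg: "0 \<le> d y" for y
      unfolding d_def by (intro integral_nonneg_AE AE_I2 K_nonneg)
    have d_int: "integrable lborel d"
      unfolding d_def[abs_def] by (rule integrable_mixture[OF real_distribution_degree_law K_meas K_nonneg K_mass])
    have "cdf (evolved_law \<kappa> W t) x = (\<integral>y. indicator {..x} y * d y \<partial>lborel)"
      unfolding law d_def[symmetric] by (rule cdf_density_lborel[OF d_int d_nonneg])
    also have "\<dots> = deg_distr \<kappa> W t x"
      unfolding deg_distr_def deg_dens_eq fker d_def[symmetric] by (rule set_integral_half_line[OF d, symmetric])
    finally show "deg_distr \<kappa> W t x = cdf (evolved_law \<kappa> W t) x" ..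
  qed
qed

section \<open>Weak convergence of the evolved degree laws\<close>

lemma cdf_evolved_law_tendsto:
  assumes S: "\<And>n. 0 < S n"
    and lim: "AE z in N. (\<lambda>n. mixture_cdf \<kappa> (tau \<alpha> (S n)) (tau \<alpha> (S n) + \<alpha>) z x) \<longlonglongrightarrow> g z"
    and g: "g \<in> borel_measurable borel"
  shows "(\<lambda>n. cdf (evolved_law \<kappa> W (S n)) x) \<longlonglongrightarrow> (\<integral>z. g z \<partial>N)"
proof -
  interpret N: real_distribution N by (rule real_distribution_degree_law)
  show ?thesis
    unfolding cdf_evolved_law[OF S]
  \<comment> \<open>Distribution functions are bounded by 1 and the degree law is a probability
    measure, so the limit may be taken for each starting point \<open>z\<close> separately.\<close>
  proof (rule integral_dominated_convergence[where w="\<lambda>_. 1"])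
    show "g \<in> borel_measurable N"
      using g by simp
    show "AE z in N. (\<lambda>n. indicator {0..} z * mixture_cdf \<kappa> (tau \<alpha> (S n)) (tau \<alpha> (S n) + \<alpha>) z x) \<longlonglongrightarrow> g z"
      using lim AE_degree_law_nonneg by eventually_elim simp
    fix n
    have pos: "0 < tau \<alpha> (S n)" "0 < tau \<alpha> (S n) + \<alpha>"
      using tau_pos[OF alpha_pos S[of n]] alpha_pos by auto
    have "(\<lambda>z. \<integral>y. indicator {..x} y * gamma_mixture \<kappa> (tau \<alpha> (S n)) (tau \<alpha> (S n) + \<alpha>) z y \<partial>lborel)
        \<in> borel_measurable borel"
    proof (rule lborel.borel_measurable_lebesgue_integral)
      show "(\<lambda>(z, y). indicator {..x} y * gamma_mixture \<kappa> (tau \<alpha> (S n)) (tau \<alpha> (S n) + \<alpha>) z y)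
          \<in> borel_measurable (borel \<Otimes>\<^sub>M lborel)"
        using gamma_mixture_measurable[OF \<kappa> pos] unfolding case_prod_unfold by measurable
    qed
    then show "(\<lambda>z. indicator {0..} z * mixture_cdf \<kappa> (tau \<alpha> (S n)) (tau \<alpha> (S n) + \<alpha>) z x) \<in> borel_measurable N"
      unfolding mixture_cdf_def by simp
    show "AE z in N. norm (indicator {0..} z * mixture_cdf \<kappa> (tau \<alpha> (S n)) (tau \<alpha> (S n) + \<alpha>) z x) \<le> 1"
      using mixture_cdf_bounds[OF \<kappa> pos] by (intro AE_I2) (auto simp: indicator_def)
  qed simp
qed

lemma weak_conv_evolved_law_start:
  assumes S: "\<And>n. 0 < S n" "S \<longlonglongrightarrow> 0"
  shows "weak_conv_m (\<lambda>n. evolved_law \<kappa> W (S n)) N"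
  unfolding weak_conv_m_def weak_conv_def
proof (intro allI impI)
  fix x assume cont: "isCont (cdf N) x"
  interpret N: real_distribution N by (rule real_distribution_degree_law)
  \<comment> \<open>A continuity point of the distribution function is no atom, so the case
    \<open>z = x\<close>, excluded in \<open>mixture_cdf_tendsto_start\<close>, has probability
    0.\<close>
  have "emeasure N {x} = 0"
    using cont N.isCont_cdf N.emeasure_eq_measure by simp
  then have "AE z in N. z \<noteq> x"
    by (intro AE_I[of _ _ "{x}"]) auto
  then have "AE z in N. (\<lambda>n. mixture_cdf \<kappa> (tau \<alpha> (S n)) (tau \<alpha> (S n) + \<alpha>) z x) \<longlonglongrightarrow> indicator {..x} z"
    using AE_degree_law_nonneg
  proof eventually_elim
    case (elim z)
    then show ?case
      using mixture_cdf_tendsto_start[OF \<kappa> alpha_pos S, of z x] by (simp add: indicator_def of_bool_def)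
  qed
  from cdf_evolved_law_tendsto[OF S(1) this]
  have "(\<lambda>n. cdf (evolved_law \<kappa> W (S n)) x) \<longlonglongrightarrow> (\<integral>z. indicator {..x} z \<partial>N)"
    by simp
  then show "(\<lambda>n. cdf (evolved_law \<kappa> W (S n)) x) \<longlonglongrightarrow> cdf N x"
    by (simp add: cdf_def)
qed

text \<open>The limit for a fixed starting point does not depend on that point, so averaging over
  the degree law returns it.\<close>

lemma weak_conv_evolved_law_infinity:
  assumes S: "\<And>n. 0 < S n" "filterlim S at_top sequentially"
  shows "weak_conv_m (\<lambda>n. evolved_law \<kappa> W (S n)) (gamma_law \<kappa> \<alpha>)"
  unfolding weak_conv_m_def weak_conv_def
proof (intro allI impI)
  fix x
  interpret N: real_distribution N by (rule real_distribution_degree_law)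
  have "AE z in N. (\<lambda>n. mixture_cdf \<kappa> (tau \<alpha> (S n)) (tau \<alpha> (S n) + \<alpha>) z x) \<longlonglongrightarrow> cdf (gamma_law \<kappa> \<alpha>) x"
    using AE_degree_law_nonneg
  proof eventually_elim
    case (elim z)
    then show ?case
      unfolding gamma_law(2)[OF \<kappa> alpha_pos] by (rule mixture_cdf_tendsto_infinity[OF \<kappa> alpha_pos S])
  qed
  from cdf_evolved_law_tendsto[OF S(1) this]
  show "(\<lambda>n. cdf (evolved_law \<kappa> W (S n)) x) \<longlonglongrightarrow> cdf (gamma_law \<kappa> \<alpha>) x"
    using N.prob_space by simp
qed

section \<open>Limits of the multigraphons built from quantile functions\<close>

lemma t_eq_mg_hat:
  assumes "0 < t"
  shows "t_eq k A (mg_hat \<kappa> W t) = poisson_density k A (mg_dens W) (evolved_law \<kappa> W t)"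
  unfolding mg_hat_def deg_distr_eq_cdf[OF assms]
  by (intro t_eq_mg_of_distr real_distribution_evolved_law cdf_evolved_law_neg assms)

lemma t_eq_mg_hat_inf:
  "t_eq k A (mg_hat_inf \<kappa> W) = poisson_density k A (mg_dens W) (gamma_law \<kappa> \<alpha>)"
proof -
  have "(\<lambda>x. LINT y:{0..x}|lborel. gamma_dens y \<kappa> \<alpha>) = cdf (gamma_law \<kappa> \<alpha>)"
    by (simp add: fun_eq_iff set_integral_half_line gamma_dens_nonpos gamma_law(2)[OF \<kappa> alpha_pos])
  then show ?thesis
    unfolding mg_hat_inf_def
    by (simp add: t_eq_mg_of_distr gamma_law[OF \<kappa> alpha_pos] indicator_integral_nonpos gamma_dens_nonpos)
qed

lemma t_eq_poisson_mg_degree: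
  "t_eq k A (poisson_mg (mg_dens W) (mg_deg W)) = poisson_density k A (mg_dens W) N"
  unfolding degree_law_def by (rule t_eq_poisson_mg[OF mg_deg_meas]) (simp add: mg_deg_nonneg)

text \<open>The densities on both sides are values of \<open>poisson_density\<close>, at the evolved
  law and at the degree law, so weak convergence of the laws decides.\<close>

lemma mg_hat_tendsto_start:
  "mg_tendsto (mg_hat \<kappa> W) (poisson_mg (mg_dens W) (mg_deg W)) (at_right 0)"
proof (rule mg_tendsto_at_right_0)
  fix S :: "nat \<Rightarrow> real"
  assume S: "\<And>n. S n > 0" "S \<longlonglongrightarrow> 0"
  show "mg_tendsto (\<lambda>n. mg_hat \<kappa> W (S n)) (poisson_mg (mg_dens W) (mg_deg W)) sequentially"
    unfolding mg_tendsto_def t_eq_mg_hat[OF S(1)] t_eq_poisson_mg_degree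
    by (intro allI impI ballI poisson_density_weak_conv real_distribution_evolved_law
        real_distribution_degree_law weak_conv_evolved_law_start S dens)
qed

lemma mg_hat_tendsto_infinity:
  "mg_tendsto (mg_hat \<kappa> W) (mg_hat_inf \<kappa> W) at_top"
proof (rule mg_tendsto_at_top)
  fix S :: "nat \<Rightarrow> real"
  assume S: "\<And>n. S n > 0" "filterlim S at_top sequentially"
  show "mg_tendsto (\<lambda>n. mg_hat \<kappa> W (S n)) (mg_hat_inf \<kappa> W) sequentially"
    unfolding mg_tendsto_def t_eq_mg_hat[OF S(1)] t_eq_mg_hat_inf
    by (intro allI impI ballI poisson_density_weak_conv real_distribution_evolved_law
        gamma_law(1) \<kappa> alpha_pos weak_conv_evolved_law_infinity S dens)
qed

end

theorem mainTheorem3: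
  fixes \<kappa> lam C :: real
    and W :: "real \<Rightarrow> real \<Rightarrow> nat \<Rightarrow> real"
    and B :: "nat \<Rightarrow> nat \<Rightarrow> nat \<Rightarrow> nat"
  assumes "\<kappa> > 0"
    and "multigraphon W"
    and "mg_rho W > 0"
    and "\<And>n. n \<ge> 1 \<Longrightarrow> B n \<in> adj_mats n"
    and "mats_tendsto B W"
    and "lam > 0"
    and "\<And>n. n \<ge> 2 \<Longrightarrow>
           1 / real (n choose 2) * (\<Sum>(i, j)\<in>{(i, j). 1 \<le> i \<and> i < j \<and> j \<le> n}.
             exp (lam * real (B n i j))) \<le> C"
    and "\<And>n. n \<ge> 1 \<Longrightarrow>
           1 / real n * (\<Sum>i=1..n. exp (lam * real (B n i i))) \<le> C"
  shows "mg_tendsto (\<lambda>t. mg_evol W t) W (at_right 0)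
       \<and> (\<exists>V. multigraphon V
              \<and> mg_tendsto (\<lambda>t. mg_evol W t) V at_top
              \<and> mg_tendsto (\<lambda>t. mg_hat \<kappa> W t) V (at_right 0))
       \<and> mg_tendsto (\<lambda>t. mg_hat \<kappa> W t) (mg_hat_inf \<kappa> W) at_top"
proof -
  have "mg_rho W < \<infinity>"
    by (rule mg_rho_finite[OF assms(2,4-8)])
  \<comment> \<open>\<open>enn2real\<close> sends infinity to 0, so finiteness of
    \<open>mg_rho W\<close> is what makes the real edge density positive.\<close>
  then have dens: "0 < mg_dens W"
    using assms(3) by (simp add: mg_dens_def enn2real_positive_iff)
  note W = \<open>multigraphon W\<close>
  \<comment> \<open>The common limit \<open>V\<close> is the Poisson multigraphon whose weight
    function is the degree function of \<open>W\<close>.\<close>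
  have "multigraphon (poisson_mg (mg_dens W) (mg_deg W))"
    by (intro multigraphon_poisson_mg mg_deg_meas[OF assms(1) W dens] mg_deg_nonneg dens)
  with mg_evol_tendsto_start[OF W] mg_evol_tendsto_infinity[OF W]
    mg_hat_tendsto_start[OF assms(1) W dens] mg_hat_tendsto_infinity[OF assms(1) W dens]
  show ?thesis
    by blast
qed

end
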